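(* Consider a square integrable copula with a sine-cosine series representation, i.e. with density $$c(u,v)=1+2\sum_{k=1}^\infty\lambda_k\cos(2\pi ku)\cos(2\pi kv)+2\sum_{k=1}^\infty\mu_k\sin(2\pi ku)\sin(2\pi kv),$$ and let $(U_0,\dots,U_n)$ be the Markov chain generated by it with the uniform marginal distribution on $(0,1)$. Put $$\hat\lambda_k=\frac1n\sum_{i=1}^n2\cos(2\pi kU_i)\cos(2\pi kU_{i-1}),\qquad \hat\mu_k=\frac1n\sum_{i=1}^n2\sin(2\pi kU_i)\sin(2\pi kU_{i-1}).$$ Assume that all parameters $\lambda_k,\mu_k$ are equal to zero. Then any vector of finitely many distinct estimators chosen among the $\hat\lambda_k,\hat\mu_k$ satisfies the $\sqrt n$-central limit theorem with variance-covariance matrix $\mathbb I_s$, where $s$ is the length of the vector and $\mathbb I_s$ is the identity matrix of dimension $s$; that is, $\sqrt n$ times the vector converges in distribution to $N_s(\mathbf 0,\mathbb I_s)$. Moreover, if $W_{n_1},W_{n_2},\dots$ is a sequence of distinct elements of $\{\hat\lambda_k,\hat\mu_k:k\ge1\}$ computed from $U_0,\dots,U_n$, then for each $s$ $$n\sum_{i=1}^sW_{n_i}^2\to\chi^2(s)\quad\text{in distribution as } n\to\infty,$$ and $$\frac1{\sqrt{2s}}\Big(n\sum_{i=1}^sW_{n_i}^2-s\Big)\to N(0,1)\quad\text{in distribution as } n\to\infty,\text{ then } s\to\infty .$$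
   Context: A copula is a bivariate cumulative distribution function with uniform marginals on $[0,1]$; it is square integrable if its density is in $L^2((0,1)^2)$. A Markov chain generated by a copula $C$ with density $c$ and the uniform marginal distribution is a stationary Markov chain $(U_i)_{i\ge0}$ with each $U_i$ uniform on $(0,1)$ and with $C$ the joint distribution function of $(U_i,U_{i+1})$; equivalently its transition density is $c(u,\cdot)$. $\chi^2(s)$ is the chi-square law with $s$ degrees of freedom. The last limit is an iterated limit: first $n\to\infty$ with $s$ fixed, then $s\to\infty$. *)

theory Defs
  imports "HOL-Probability.Probability"
begin

definition is_copula :: "(real \<Rightarrow> real \<Rightarrow> real) \<Rightarrow> bool" where
  "is_copula C \<longleftrightarrow> (\<exists>P :: (real \<times> real) measure. prob_space P \<and> sets P = sets borel
     \<and> distr P borel fst = uniform_measure lborel {0..1}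
     \<and> distr P borel snd = uniform_measure lborel {0..1}
     \<and> (\<forall>u v. C u v = measure P ({..u} \<times> {..v})))"

abbreviation unit_square :: "(real \<times> real) set" where
  "unit_square \<equiv> {0<..<1} \<times> {0<..<1}"

definition copula_density :: "(real \<Rightarrow> real \<Rightarrow> real) \<Rightarrow> (real \<Rightarrow> real \<Rightarrow> real) \<Rightarrow> bool" where
  "copula_density C c \<longleftrightarrow> (\<lambda>(u, v). c u v) \<in> borel_measurable borel
     \<and> (AE (u, v) in lborel. (u, v) \<in> unit_square \<longrightarrow> 0 \<le> c u v)
     \<and> (\<forall>u v. C u v = measure
          (density lborel (\<lambda>(x, y). indicator unit_square (x, y) * ennreal (c x y))) ({..u} \<times> {..v}))"

definition square_integrable_copula ::
  "(real \<Rightarrow> real \<Rightarrow> real) \<Rightarrow> (real \<Rightarrow> real \<Rightarrow> real) \<Rightarrow> bool" where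
  "square_integrable_copula C c \<longleftrightarrow> is_copula C \<and> copula_density C c
     \<and> set_integrable lborel unit_square (\<lambda>(u, v). (c u v)\<^sup>2)"

definition sine_cosine_partial_sum ::
  "(nat \<Rightarrow> real) \<Rightarrow> (nat \<Rightarrow> real) \<Rightarrow> nat \<Rightarrow> real \<Rightarrow> real \<Rightarrow> real" where
  "sine_cosine_partial_sum lam mu N u v =
     1 + 2 * (\<Sum>k=1..N. lam k * cos (2 * pi * real k * u) * cos (2 * pi * real k * v))
       + 2 * (\<Sum>k=1..N. mu k * sin (2 * pi * real k * u) * sin (2 * pi * real k * v))"

text \<open>The series of a square integrable density converges in the L2 norm on the unit square
  (a density is only determined up to null sets).\<close>

definition sine_cosine_series ::
  "(real \<Rightarrow> real \<Rightarrow> real) \<Rightarrow> (nat \<Rightarrow> real) \<Rightarrow> (nat \<Rightarrow> real) \<Rightarrow> bool" where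
  "sine_cosine_series c lam mu \<longleftrightarrow>
     (\<lambda>N. set_lebesgue_integral lborel unit_square
        (\<lambda>(u, v). (c u v - sine_cosine_partial_sum lam mu N u v)\<^sup>2)) \<longlonglongrightarrow> 0"

text \<open>The Markov property: conditioning on the sigma-algebra generated by the first \<open>n + 1\<close>
  variables is the same as conditioning on the one generated by the last of them.\<close>

definition markov_property :: "'a measure \<Rightarrow> (nat \<Rightarrow> 'a \<Rightarrow> real) \<Rightarrow> bool" where
  "markov_property M U \<longleftrightarrow> (\<forall>n. \<forall>A \<in> sets borel. AE \<omega> in M.
     real_cond_exp M
       (vimage_algebra (space M) (\<lambda>\<omega>. \<lambda>i\<in>{..n}. U i \<omega>) (PiM {..n} (\<lambda>_. borel)))
       (\<lambda>\<omega>. indicator A (U (Suc n) \<omega>)) \<omega>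
     = real_cond_exp M (vimage_algebra (space M) (U n) borel)
       (\<lambda>\<omega>. indicator A (U (Suc n) \<omega>)) \<omega>)"

definition copula_markov_chain ::
  "'a measure \<Rightarrow> (real \<Rightarrow> real \<Rightarrow> real) \<Rightarrow> (nat \<Rightarrow> 'a \<Rightarrow> real) \<Rightarrow> bool" where
  "copula_markov_chain M C U \<longleftrightarrow>
     (\<forall>i. U i \<in> borel_measurable M)
     \<and> (\<forall>i. distr M borel (U i) = uniform_measure lborel {0<..<1})
     \<and> (\<forall>i u v. measure M {\<omega> \<in> space M. U i \<omega> \<le> u \<and> U (Suc i) \<omega> \<le> v} = C u v)
     \<and> markov_property M U"

definition lambda_hat :: "(nat \<Rightarrow> 'a \<Rightarrow> real) \<Rightarrow> nat \<Rightarrow> nat \<Rightarrow> 'a \<Rightarrow> real" where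
  "lambda_hat U k n \<omega> = (1 / real n) *
     (\<Sum>i=1..n. 2 * cos (2 * pi * real k * U i \<omega>) * cos (2 * pi * real k * U (i - 1) \<omega>))"

definition mu_hat :: "(nat \<Rightarrow> 'a \<Rightarrow> real) \<Rightarrow> nat \<Rightarrow> nat \<Rightarrow> 'a \<Rightarrow> real" where
  "mu_hat U k n \<omega> = (1 / real n) *
     (\<Sum>i=1..n. 2 * sin (2 * pi * real k * U i \<omega>) * sin (2 * pi * real k * U (i - 1) \<omega>))"

text \<open>Labels of the estimators; distinct estimators are those with distinct labels.\<close>

datatype label = Lambda nat | Mu nat

definition labels :: "label set" where
  "labels = Lambda ` {1..} \<union> Mu ` {1..}"

fun estimator :: "(nat \<Rightarrow> 'a \<Rightarrow> real) \<Rightarrow> label \<Rightarrow> nat \<Rightarrow> 'a \<Rightarrow> real" where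
  "estimator U (Lambda k) = lambda_hat U k"
| "estimator U (Mu k) = mu_hat U k"

text \<open>Weak convergence of measures on a general space; \<^const>\<open>weak_conv_m\<close> is only for the real line.\<close>

definition weakly_converges ::
  "(nat \<Rightarrow> 'b::topological_space measure) \<Rightarrow> 'b measure \<Rightarrow> bool" where
  "weakly_converges P Q \<longleftrightarrow> (\<forall>f :: 'b \<Rightarrow> real. continuous_on UNIV f \<and> bounded (range f) \<longrightarrow>
     (\<lambda>n. integral\<^sup>L (P n) f) \<longlonglongrightarrow> integral\<^sup>L Q f)"

text \<open>The normal law on \<open>\<real>\<^sup>s\<close> with mean \<open>m\<close> and invertible covariance matrix \<open>S\<close>.\<close>

definition normal_distribution :: "real ^ 's \<Rightarrow> real ^ 's ^ 's \<Rightarrow> (real ^ 's) measure" where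
  "normal_distribution m S = density lborel (\<lambda>x. ennreal
     (exp (- ((x - m) \<bullet> (matrix_inv S *v (x - m))) / 2) / sqrt ((2 * pi) ^ CARD('s) * det S)))"

text \<open>The law of the sum of squares of \<open>s\<close> independent standard normal variables.\<close>

definition chi_square :: "nat \<Rightarrow> real measure" where
  "chi_square s = distr (PiM {1..s} (\<lambda>_. std_normal_distribution)) borel (\<lambda>z. \<Sum>i=1..s. (z i)\<^sup>2)"

end

theory Submission
  imports Defs
begin

text \<open>
  When all coefficients vanish, the squared \<open>L\<^sup>2\<close> distance between \<open>c\<close> and the constant 1 is the limit
  of a sequence that is constantly this distance, so \<open>c = 1\<close> almost everywhere on the unit square and
  \<open>C\<close> is the independence copula. Together with the Markov property this makes \<open>U (n + 1)\<close>
  independent of the whole past \<open>(U 0, \<dots>, U n)\<close>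
  (\<open>independent_chain_if_parameters_vanish\<close>, \<open>indep_var_past_next\<close>).

  With \<open>\<phi>\<close> ranging over the orthonormal system \<open>\<surd>2 cos (2 \<pi> k x)\<close>, \<open>\<surd>2 sin (2 \<pi> k x)\<close>, the square root
  of \<open>n\<close> times an estimator is \<open>n\<close> to the power \<open>-1/2\<close> times the sum of \<open>\<phi> (U i) * \<phi> (U (i + 1))\<close> over
  \<open>i < n\<close>. A linear combination of estimators with coefficients \<open>t j\<close> is therefore a normalised sum of
  bounded steps. Since each \<open>\<phi>\<close> has mean zero, the steps are martingale differences; by orthonormality
  their variance is \<open>v = \<Sum> (t j)\<^sup>2\<close>, and the squares of two steps that are at least two apart are
  uncorrelated.

  The central limit theorem for such sums (\<open>characteristic_clt_of_martingale_products\<close>) is McLeish's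
  argument: \<open>e\<^sup>i\<^sup>x\<close> is \<open>(1 + i x) exp (- x\<^sup>2 / 2)\<close> up to a cubic error, the product of the factors
  \<open>1 + i x\<close> has expectation exactly 1 because the steps are martingale differences, and the sum of the
  \<open>x\<^sup>2\<close> is close to \<open>v\<close> by the law of large numbers.

  One-dimensional characteristic functions of all linear combinations determine weak convergence in
  several dimensions. This is shown by the Stone-Weierstrass theorem: cosines of linear forms span an
  algebra that separates points, and second moments give tightness
  (\<open>weakly_converges_if_linear_phases_converge\<close>). The criterion is stated for an abstract space with
  finitely many coordinate functions, since it is applied twice: to Euclidean space, whose dimension is
  a type, for the vector of estimators, and to sequences supported on \<open>{1..s}\<close>, where \<open>s\<close> may vary,
  for the sum of squares. The latter limit is the image of a standard normal vector under a continuous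
  map, that is, the chi-square law. Standardising it and letting \<open>s\<close> tend to infinity is the classical
  central limit theorem for squares of independent standard normal variables (\<open>chi_square_clt\<close>).
\<close>

section \<open>A central limit theorem for bounded martingale differences\<close>

text \<open>Both numbers agree with \<open>1 + i x - x\<^sup>2 / 2\<close> up to third order: the first by Taylor's formula, the second
  because \<open>exp (- x\<^sup>2 / 2)\<close> exceeds \<open>1 - x\<^sup>2 / 2\<close> by at most \<open>x\<^sup>4 / 4\<close>. Bounding one factor of \<open>x\<^sup>4\<close> by \<open>B\<close>
  makes the error cubic throughout.\<close>

lemma cmod_iexp_minus_martingale_factor:
  fixes x B :: real
  assumes "\<bar>x\<bar> \<le> B"
  shows "cmod (iexp x - (1 + \<i> * x) * exp (- x\<^sup>2 / 2)) \<le> (1 + B + B\<^sup>2) * \<bar>x\<bar> ^ 3"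
proof -
  define r where "r = exp (- x\<^sup>2 / 2) - (1 - x\<^sup>2 / 2)"
  have r0: "0 \<le> r" using exp_ge_add_one_self[of "- x\<^sup>2 / 2"] by (simp add: r_def)
  have r1: "r \<le> x ^ 4 / 4"
  proof -
    have "exp (- x\<^sup>2 / 2) = 1 / exp (x\<^sup>2 / 2)" by (simp add: exp_minus field_simps)
    also have "\<dots> \<le> 1 / (1 + x\<^sup>2 / 2)"
      using exp_ge_add_one_self[of "x\<^sup>2 / 2"] by (intro divide_left_mono) (auto intro!: mult_pos_pos add_pos_nonneg)
    also have "\<dots> \<le> 1 - x\<^sup>2 / 2 + x ^ 4 / 4"
    proof -
      have "1 \<le> (1 - x\<^sup>2 / 2 + x ^ 4 / 4) * (1 + x\<^sup>2 / 2)"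
      proof -
        have "(1 - x\<^sup>2 / 2 + x ^ 4 / 4) * (1 + x\<^sup>2 / 2) = 1 + (x ^ 3)\<^sup>2 / 8"
          by (simp add: algebra_simps power2_eq_square power3_eq_cube power4_eq_xxxx)
        thus ?thesis by simp
      qed
      moreover have "0 < 1 + x\<^sup>2 / 2" by (intro add_pos_nonneg) auto
      ultimately show ?thesis by (simp add: pos_divide_le_eq)
    qed
    finally show ?thesis by (simp add: r_def)
  qed
  have e: "complex_of_real (exp (- x\<^sup>2 / 2)) = 1 - x\<^sup>2 / 2 + r" by (simp add: r_def)
  have "iexp x - (1 + \<i> * x) * exp (- x\<^sup>2 / 2)
      = (iexp x - (1 + \<i> * x - x\<^sup>2 / 2)) + \<i> * (x ^ 3 / 2) - (1 + \<i> * x) * r"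
    unfolding e by (simp add: algebra_simps power2_eq_square power3_eq_cube)
  also have "cmod \<dots> \<le> cmod (iexp x - (1 + \<i> * x - x\<^sup>2 / 2)) + cmod (\<i> * (x ^ 3 / 2)) + cmod ((1 + \<i> * x) * r)"
    by (meson norm_triangle_ineq norm_triangle_ineq4 order_trans add_mono order_refl)
  also have "cmod (iexp x - (1 + \<i> * x - x\<^sup>2 / 2)) \<le> \<bar>x\<bar> ^ 3 / 6"
    using iexp_approx1[of x 2] by (simp add: eval_nat_numeral power2_eq_square algebra_simps)
  also have "cmod (\<i> * (x ^ 3 / 2)) = \<bar>x\<bar> ^ 3 / 2"
    by (simp add: norm_mult norm_power norm_divide)
  also have "cmod ((1 + \<i> * x) * r) \<le> (1 + \<bar>x\<bar>) * (\<bar>x\<bar> ^ 3 * \<bar>x\<bar> / 4)"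
  proof -
    have "cmod (1 + \<i> * x) \<le> 1 + \<bar>x\<bar>"
      using norm_triangle_ineq[of 1 "\<i> * complex_of_real x"] by (simp add: norm_mult)
    moreover have "x ^ 4 = \<bar>x\<bar> ^ 3 * \<bar>x\<bar>"
      by (simp add: power4_eq_xxxx power3_eq_cube abs_mult_self_eq)
    ultimately show ?thesis using r0 r1 unfolding norm_mult by (intro mult_mono) auto
  qed
  also have "\<dots> \<le> (1 + B) * (\<bar>x\<bar> ^ 3 * B / 4)"
    using assms by (intro mult_mono divide_right_mono) auto
  also have "\<bar>x\<bar> ^ 3 / 6 + \<bar>x\<bar> ^ 3 / 2 + (1 + B) * (\<bar>x\<bar> ^ 3 * B / 4) = (2/3 + B/4 + B\<^sup>2/4) * \<bar>x\<bar> ^ 3"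
    by (simp add: algebra_simps power2_eq_square)
  also have "\<dots> \<le> (1 + B + B\<^sup>2) * \<bar>x\<bar> ^ 3"
  proof (rule mult_right_mono)
    have "0 \<le> B" "0 \<le> B\<^sup>2" using assms by auto
    thus "2/3 + B/4 + B\<^sup>2/4 \<le> 1 + B + B\<^sup>2" by linarith
  qed simp
  finally show ?thesis by (simp add: add_mono)
qed

text \<open>This bound serves twice: it shows that the factors \<open>(1 + i x) exp (- x\<^sup>2 / 2)\<close> lie in the unit disc,
  and it controls products of factors \<open>1 + i x\<close> by the sum of the squares.\<close>

lemma cmod_one_plus_imaginary_le_exp: "cmod (1 + \<i> * complex_of_real x) \<le> exp (x\<^sup>2 / 2)"
proof -
  have "cmod (1 + \<i> * complex_of_real x) = sqrt (1 + x\<^sup>2)"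
    by (simp add: cmod_def)
  also have "\<dots> \<le> sqrt (exp (x\<^sup>2))"
    using exp_ge_add_one_self[of "x\<^sup>2"] by simp
  also have "\<dots> = exp (x\<^sup>2 / 2)"
    by (intro real_sqrt_unique) (auto simp: power2_eq_square exp_add[symmetric])
  finally show ?thesis .
qed

text \<open>Put \<open>x i = X i / \<surd>n\<close>, \<open>T = \<Prod> (1 + i x i)\<close> and \<open>W = \<Sum> (x i)\<^sup>2\<close>. All factors lie in the unit disc, so the errors
  of replacing each \<open>exp (i x i)\<close> by \<open>(1 + i x i) exp (- (x i)\<^sup>2 / 2)\<close> add up to at most \<open>K / \<surd>n\<close>. It remains to
  replace \<open>W\<close> by \<open>v\<close> in the expectation of \<open>T exp (- W / 2)\<close>; as \<open>T\<close> is bounded uniformly in \<open>n\<close>, this costs a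
  multiple of the expectation of \<open>\<bar>W - v\<bar>\<close>. The hypothesis on the expectations of products stands for the
  martingale property, and the one on squares for the law of large numbers.\<close>

lemma (in prob_space) characteristic_clt_of_martingale_products:
  fixes X :: "nat \<Rightarrow> 'a \<Rightarrow> real"
  assumes X[measurable]: "\<And>i. X i \<in> borel_measurable M"
    and bnd: "\<And>i \<omega>. \<bar>X i \<omega>\<bar> \<le> B"
    and prods: "\<And>u m. expectation (\<lambda>\<omega>. \<Prod>i<m. (1 + \<i> * complex_of_real (u * X i \<omega>))) = 1"
    and lln: "\<And>n. expectation (\<lambda>\<omega>. (\<Sum>i<n. (X i \<omega>)\<^sup>2 - v)\<^sup>2) \<le> D * real n"
    and v: "0 \<le> v"
  shows "(\<lambda>n. expectation (\<lambda>\<omega>. iexp ((\<Sum>i<n. X i \<omega>) / sqrt n))) \<longlonglongrightarrow> exp (- v / 2)"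
proof -
  have B: "0 \<le> B" using bnd[of 0 undefined] by linarith
  have "0 \<le> expectation (\<lambda>\<omega>. (\<Sum>i<1. (X i \<omega>)\<^sup>2 - v)\<^sup>2)" by simp
  hence D: "0 \<le> D" using lln[of 1] by linarith
  define K where "K = (1 + B + B\<^sup>2) * B ^ 3"
  define G where "G = exp (B\<^sup>2 / 2) / 2"
  have key: "cmod (expectation (\<lambda>\<omega>. iexp ((\<Sum>i<n. X i \<omega>) / sqrt n)) - exp (- v / 2))
      \<le> K / sqrt n + G * sqrt (D / n)" if n: "n \<ge> 1" for n
  proof -
    define x where "x i \<omega> = (1 / sqrt n) * X i \<omega>" for i \<omega>
    define T where "T \<omega> = (\<Prod>i<n. (1 + \<i> * complex_of_real (x i \<omega>)))" for \<omega>
    define W where "W \<omega> = (\<Sum>i<n. (X i \<omega>)\<^sup>2) / n" for \<omega>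
    have [measurable]: "x i \<in> borel_measurable M" for i unfolding x_def by measurable
    have [measurable]: "T \<in> borel_measurable M" unfolding T_def by measurable
    have [measurable]: "W \<in> borel_measurable M" unfolding W_def by measurable
    have sn: "1 \<le> sqrt n" using n by simp
    have xb: "\<bar>x i \<omega>\<bar> \<le> B / sqrt n" for i \<omega>
      using bnd[of i \<omega>] sn by (simp add: x_def abs_mult divide_right_mono)
    have xB: "\<bar>x i \<omega>\<bar> \<le> B" for i \<omega>
    proof -
      have "B / sqrt n \<le> B / 1" using sn B by (intro divide_left_mono) auto
      thus ?thesis using xb[of i \<omega>] by simp
    qed
    have W2: "(\<Sum>i<n. (x i \<omega>)\<^sup>2) = W \<omega>" for \<omega>
      using n by (simp add: x_def W_def power_mult_distrib power_divide sum_divide_distrib)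
    have W0: "0 \<le> W \<omega>" for \<omega> unfolding W2[symmetric] by (simp add: sum_nonneg)
    have WB: "W \<omega> \<le> B\<^sup>2" for \<omega>
    proof -
      have "(\<Sum>i<n. (X i \<omega>)\<^sup>2) \<le> (\<Sum>i<n. B\<^sup>2)"
        by (intro sum_mono) (metis bnd power_mono abs_ge_zero power2_abs)
      thus ?thesis using n by (simp add: W_def field_simps)
    qed
    have Tb: "cmod (T \<omega>) \<le> exp (B\<^sup>2 / 2)" for \<omega>
    proof -
      have "cmod (T \<omega>) = (\<Prod>i<n. cmod (1 + \<i> * complex_of_real (x i \<omega>)))"
        by (simp add: T_def prod_norm[symmetric])
      also have "\<dots> \<le> (\<Prod>i<n. exp ((x i \<omega>)\<^sup>2 / 2))"
        by (intro prod_mono conjI cmod_one_plus_imaginary_le_exp) auto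
      also have "\<dots> = exp (W \<omega> / 2)"
        by (simp add: exp_sum[symmetric] sum_divide_distrib[symmetric] W2)
      also have "\<dots> \<le> exp (B\<^sup>2 / 2)" using WB by simp
      finally show ?thesis .
    qed
    have pw: "cmod (iexp ((\<Sum>i<n. X i \<omega>) / sqrt n) - T \<omega> * exp (- W \<omega> / 2)) \<le> K / sqrt n" for \<omega>
    proof -
      have 1: "iexp ((\<Sum>i<n. X i \<omega>) / sqrt n) = (\<Prod>i<n. iexp (x i \<omega>))"
        by (simp add: exp_sum[symmetric] x_def sum_distrib_left sum_divide_distrib)
      have 2: "T \<omega> * exp (- W \<omega> / 2) = (\<Prod>i<n. (1 + \<i> * x i \<omega>) * exp (- (x i \<omega>)\<^sup>2 / 2))"
        unfolding T_def prod.distrib W2[symmetric]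
        by (simp add: exp_sum[symmetric] sum_divide_distrib[symmetric] sum_negf of_real_prod[symmetric] del: of_real_prod)
      have f1: "cmod ((1 + \<i> * x i \<omega>) * exp (- (x i \<omega>)\<^sup>2 / 2)) \<le> 1" for i
      proof -
        have "cmod ((1 + \<i> * x i \<omega>) * exp (- (x i \<omega>)\<^sup>2 / 2))
            \<le> exp ((x i \<omega>)\<^sup>2 / 2) * exp (- (x i \<omega>)\<^sup>2 / 2)"
          unfolding norm_mult by (intro mult_mono cmod_one_plus_imaginary_le_exp) auto
        thus ?thesis by (simp add: exp_add[symmetric])
      qed
      have "cmod ((\<Prod>i<n. iexp (x i \<omega>)) - (\<Prod>i<n. (1 + \<i> * x i \<omega>) * exp (- (x i \<omega>)\<^sup>2 / 2)))
          \<le> (\<Sum>i<n. cmod (iexp (x i \<omega>) - (1 + \<i> * x i \<omega>) * exp (- (x i \<omega>)\<^sup>2 / 2)))"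
        by (intro norm_prod_diff f1) auto
      also have "\<dots> \<le> (\<Sum>i<n. (1 + B + B\<^sup>2) * (B / sqrt n) ^ 3)"
        using B by (intro sum_mono order_trans[OF cmod_iexp_minus_martingale_factor[OF xB]] mult_left_mono power_mono xb) auto
      also have "\<dots> = K / sqrt n"
      proof -
        have "real n = sqrt n * sqrt n" by simp
        hence "n * (B / sqrt n) ^ 3 = B ^ 3 / sqrt n"
          using sn by (simp add: power_divide power3_eq_cube field_simps)
        hence "(1 + B + B\<^sup>2) * (n * (B / sqrt n) ^ 3) = K / sqrt n" by (simp add: K_def)
        thus ?thesis by (simp add: mult.left_commute del: power_divide)
      qed
      finally show ?thesis unfolding 1 2 .
    qed
    have iT: "integrable M T" by (rule integrable_const_bound[of _ "exp (B\<^sup>2 / 2)"]) (auto simp: Tb)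
    have iTW: "integrable M (\<lambda>\<omega>. T \<omega> * exp (- W \<omega> / 2))"
    proof (rule integrable_const_bound[of _ "exp (B\<^sup>2 / 2) * 1"])
      show "AE \<omega> in M. cmod (T \<omega> * exp (- W \<omega> / 2)) \<le> exp (B\<^sup>2 / 2) * 1"
        unfolding norm_mult using W0 Tb by (intro AE_I2 mult_mono) auto
    qed measurable
    have iI: "integrable M (\<lambda>\<omega>. iexp ((\<Sum>i<n. X i \<omega>) / sqrt n))"
      by (rule integrable_const_bound[of _ 1]) auto
    have "cmod (expectation (\<lambda>\<omega>. iexp ((\<Sum>i<n. X i \<omega>) / sqrt n)) - expectation (\<lambda>\<omega>. T \<omega> * exp (- W \<omega> / 2)))
        \<le> expectation (\<lambda>\<omega>. cmod (iexp ((\<Sum>i<n. X i \<omega>) / sqrt n) - T \<omega> * exp (- W \<omega> / 2)))"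
      using iI iTW by (simp add: Bochner_Integration.integral_diff[symmetric] del: Bochner_Integration.integral_diff)
    also have "\<dots> \<le> expectation (\<lambda>\<omega>. K / sqrt n)"
      by (intro integral_mono integrable_norm Bochner_Integration.integrable_diff iI iTW pw) simp
    also have "\<dots> = K / sqrt n" by (simp add: prob_space)
    finally have part1: "cmod (expectation (\<lambda>\<omega>. iexp ((\<Sum>i<n. X i \<omega>) / sqrt n)) - expectation (\<lambda>\<omega>. T \<omega> * exp (- W \<omega> / 2)))
        \<le> K / sqrt n" .
    have ET: "expectation T = 1" unfolding T_def x_def by (rule prods)
    have iWv: "integrable M (\<lambda>\<omega>. (W \<omega> - v)\<^sup>2)"
    proof (rule integrable_const_bound[of _ "(B\<^sup>2 + v)\<^sup>2"])
      have "\<bar>W \<omega> - v\<bar> \<le> B\<^sup>2 + v" for \<omega> using WB[of \<omega>] W0[of \<omega>] v by (simp add: abs_le_iff)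
      thus "AE \<omega> in M. norm ((W \<omega> - v)\<^sup>2) \<le> (B\<^sup>2 + v)\<^sup>2"
        using power_mono[of "\<bar>W \<omega> - v\<bar>" "B\<^sup>2 + v" 2 for \<omega>] by auto
    qed measurable
    have iWa: "integrable M (\<lambda>\<omega>. \<bar>W \<omega> - v\<bar>)"
      using square_integrable_imp_integrable[OF _ iWv] by auto
    have "expectation (\<lambda>\<omega>. \<bar>W \<omega> - v\<bar>) \<le> sqrt (expectation (\<lambda>\<omega>. (W \<omega> - v)\<^sup>2))"
    proof -
      have "0 \<le> variance (\<lambda>\<omega>. \<bar>W \<omega> - v\<bar>)" by (rule variance_positive)
      also have "\<dots> = expectation (\<lambda>\<omega>. (W \<omega> - v)\<^sup>2) - (expectation (\<lambda>\<omega>. \<bar>W \<omega> - v\<bar>))\<^sup>2"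
        using iWa iWv by (subst variance_eq) auto
      finally show ?thesis by (intro real_le_rsqrt) simp
    qed
    also have "\<dots> \<le> sqrt (D / n)"
    proof (rule real_sqrt_le_mono)
      have "(W \<omega> - v)\<^sup>2 = (\<Sum>i<n. (X i \<omega>)\<^sup>2 - v)\<^sup>2 / (real n)\<^sup>2" for \<omega>
        using n by (simp add: W_def sum_subtractf power_divide[symmetric] diff_divide_distrib)
      hence "expectation (\<lambda>\<omega>. (W \<omega> - v)\<^sup>2) = expectation (\<lambda>\<omega>. (\<Sum>i<n. (X i \<omega>)\<^sup>2 - v)\<^sup>2) / (real n)\<^sup>2"
        by simp
      also have "\<dots> \<le> D * n / (real n)\<^sup>2" by (intro divide_right_mono lln) auto
      also have "\<dots> = D / n" using n by (simp add: power2_eq_square)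
      finally show "expectation (\<lambda>\<omega>. (W \<omega> - v)\<^sup>2) \<le> D / n" .
    qed
    finally have EW: "expectation (\<lambda>\<omega>. \<bar>W \<omega> - v\<bar>) \<le> sqrt (D / n)" .
    have iD: "integrable M (\<lambda>\<omega>. T \<omega> * (complex_of_real (exp (- W \<omega> / 2)) - exp (- v / 2)))"
      unfolding right_diff_distrib using iTW iT by auto
    have "expectation (\<lambda>\<omega>. T \<omega> * exp (- W \<omega> / 2)) - exp (- v / 2)
        = expectation (\<lambda>\<omega>. T \<omega> * (complex_of_real (exp (- W \<omega> / 2)) - exp (- v / 2)))"
      unfolding right_diff_distrib using iTW iT by (subst Bochner_Integration.integral_diff) (auto simp: ET)
    also have "cmod \<dots> \<le> expectation (\<lambda>\<omega>. cmod (T \<omega> * (complex_of_real (exp (- W \<omega> / 2)) - exp (- v / 2))))"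
      by simp
    also have "\<dots> \<le> expectation (\<lambda>\<omega>. G * \<bar>W \<omega> - v\<bar>)"
    proof (intro integral_mono)
      fix \<omega>
      \<comment> \<open>The exponential function is 1-Lipschitz on the negative half-line.\<close>
      have lip: "\<bar>exp (- s) - exp (- r)\<bar> \<le> \<bar>s - r\<bar>" if "0 \<le> s" "0 \<le> r" for s r :: real
      proof -
        have *: "exp (- a) - exp (- b) \<le> b - a" "exp (- b) \<le> exp (- a)" if "0 \<le> a" "a \<le> b" for a b :: real
        proof -
          have "exp (- a) - exp (- b) = exp (- a) * (1 - exp (- (b - a)))"
            by (simp add: right_diff_distrib exp_add[symmetric])
          also have "\<dots> \<le> 1 * (b - a)"
            using that exp_ge_add_one_self[of "- (b - a)"]
            by (intro mult_mono) (simp_all only: exp_le_one_iff exp_ge_zero, simp_all)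
          finally show "exp (- a) - exp (- b) \<le> b - a" by simp
        qed (use that in auto)
        show ?thesis
        proof (cases "s \<le> r")
          case True
          then show ?thesis using *[OF that(1) True] by simp
        next
          case False
          then show ?thesis using *[OF that(2), of s] by simp
        qed
      qed
      have "cmod (complex_of_real (exp (- W \<omega> / 2)) - exp (- v / 2)) = \<bar>exp (- (W \<omega> / 2)) - exp (- (v / 2))\<bar>"
        by (metis minus_divide_left norm_of_real of_real_diff)
      also have "\<dots> \<le> \<bar>W \<omega> / 2 - v / 2\<bar>" using W0 v by (intro lip) auto
      finally have "cmod (complex_of_real (exp (- W \<omega> / 2)) - exp (- v / 2)) \<le> \<bar>W \<omega> - v\<bar> / 2" by simp
      hence "cmod (T \<omega>) * cmod (complex_of_real (exp (- W \<omega> / 2)) - exp (- v / 2)) \<le> exp (B\<^sup>2 / 2) * (\<bar>W \<omega> - v\<bar> / 2)"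
        using Tb by (intro mult_mono) auto
      thus "cmod (T \<omega> * (complex_of_real (exp (- W \<omega> / 2)) - exp (- v / 2))) \<le> G * \<bar>W \<omega> - v\<bar>"
        by (simp only: norm_mult G_def times_divide_eq_right times_divide_eq_left)
    qed (use iD iWa in auto)
    also have "\<dots> = G * expectation (\<lambda>\<omega>. \<bar>W \<omega> - v\<bar>)" by simp
    also have "\<dots> \<le> G * sqrt (D / n)" by (intro mult_left_mono EW) (simp add: G_def)
    finally have part2: "cmod (expectation (\<lambda>\<omega>. T \<omega> * exp (- W \<omega> / 2)) - exp (- v / 2)) \<le> G * sqrt (D / n)" .
    show ?thesis using norm_triangle_le[OF add_mono[OF part1 part2]] by simp
  qed
  have lim: "(\<lambda>n. K / sqrt (real n) + G * sqrt (D / real n)) \<longlonglongrightarrow> 0"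
  proof -
    have "(\<lambda>n. sqrt (1 / real n)) \<longlonglongrightarrow> 0"
      using tendsto_real_sqrt[OF lim_inverse_n'] by simp
    hence "(\<lambda>n. K * sqrt (1 / real n) + G * (sqrt D * sqrt (1 / real n))) \<longlonglongrightarrow> K * 0 + G * (sqrt D * 0)"
      by (intro tendsto_intros)
    thus ?thesis by (simp add: real_sqrt_divide)
  qed
  have "(\<lambda>n. expectation (\<lambda>\<omega>. iexp ((\<Sum>i<n. X i \<omega>) / sqrt n)) - exp (- v / 2)) \<longlonglongrightarrow> 0"
    by (rule Lim_null_comparison[OF _ lim]) (use key in \<open>auto simp: eventually_sequentially\<close>)
  thus ?thesis by (simp add: LIM_zero_iff)
qed

section \<open>Weak convergence from the convergence of linear phases\<close>

text \<open>The real span of the cosines with a phase in \<open>L\<close>. The free shift \<open>a\<close> also provides the sines, so no complex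
  numbers are needed for the span to be closed under multiplication.\<close>

inductive_set phase_functions :: "('b \<Rightarrow> real) set \<Rightarrow> ('b \<Rightarrow> real) set" for L where
  cosine: "\<tau> \<in> L \<Longrightarrow> (\<lambda>x. cos (\<tau> x + a)) \<in> phase_functions L"
| scale: "f \<in> phase_functions L \<Longrightarrow> (\<lambda>x. c * f x) \<in> phase_functions L"
| add: "f \<in> phase_functions L \<Longrightarrow> g \<in> phase_functions L \<Longrightarrow> (\<lambda>x. f x + g x) \<in> phase_functions L"

lemma phase_functions_bounded:
  "f \<in> phase_functions L \<Longrightarrow> \<exists>B. \<forall>x. \<bar>f x\<bar> \<le> B"
proof (induction rule: phase_functions.induct)
  case (cosine \<tau> a) thus ?case by (intro exI[of _ 1]) auto
next
  case (scale f c)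
  then obtain B where "\<forall>x. \<bar>f x\<bar> \<le> B" by blast
  thus ?case by (intro exI[of _ "\<bar>c\<bar> * B"]) (auto simp: abs_mult mult_left_mono)
next
  case (add f g)
  then obtain B B' where "\<forall>x. \<bar>f x\<bar> \<le> B" "\<forall>x. \<bar>g x\<bar> \<le> B'" by blast
  thus ?case by (intro exI[of _ "B + B'"]) (meson abs_triangle_ineq add_mono order_trans)
qed

lemma phase_functions_continuous:
  fixes L :: "('b::t2_space \<Rightarrow> real) set"
  assumes "\<And>\<tau>. \<tau> \<in> L \<Longrightarrow> continuous_on UNIV \<tau>"
    and "f \<in> phase_functions L"
  shows "continuous_on UNIV f"
  using assms(2)
proof (induction rule: phase_functions.induct)
  case (cosine \<tau> a)
  have "continuous_on UNIV \<tau>" using assms(1) cosine by blast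
  thus ?case by (intro continuous_on_cos continuous_on_add continuous_on_const)
qed (auto intro: continuous_intros)

lemma phase_functions_mult:
  assumes L: "\<And>\<tau> \<tau>'. \<tau> \<in> L \<Longrightarrow> \<tau>' \<in> L \<Longrightarrow> (\<lambda>x. \<tau> x + \<tau>' x) \<in> L" "\<And>\<tau>. \<tau> \<in> L \<Longrightarrow> (\<lambda>x. - \<tau> x) \<in> L"
    and f: "f \<in> phase_functions L" and g: "g \<in> phase_functions L"
  shows "(\<lambda>x. f x * g x) \<in> phase_functions L"
  using f
proof (induction rule: phase_functions.induct)
  case (cosine \<tau> a)
  show ?case using g
  proof (induction rule: phase_functions.induct)
    case (cosine \<tau>' b)
    have "(\<lambda>x. \<tau> x + \<tau>' x) \<in> L" "(\<lambda>x. \<tau> x + - \<tau>' x) \<in> L"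
      using L(1)[OF \<open>\<tau> \<in> L\<close> cosine] L(1)[OF \<open>\<tau> \<in> L\<close> L(2)[OF cosine]] by auto
    from this[THEN phase_functions.cosine]
    have "(\<lambda>x. (1/2) * (cos ((\<tau> x + - \<tau>' x) + (a - b)) + cos ((\<tau> x + \<tau>' x) + (a + b)))) \<in> phase_functions L"
      by (intro phase_functions.scale phase_functions.add)
    also have "(\<lambda>x. (1/2) * (cos ((\<tau> x + - \<tau>' x) + (a - b)) + cos ((\<tau> x + \<tau>' x) + (a + b))))
        = (\<lambda>x. cos (\<tau> x + a) * cos (\<tau>' x + b))"
    proof
      fix x
      have "(\<tau> x + - \<tau>' x) + (a - b) = (\<tau> x + a) - (\<tau>' x + b)"
           "(\<tau> x + \<tau>' x) + (a + b) = (\<tau> x + a) + (\<tau>' x + b)" by simp_all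
      thus "(1/2) * (cos ((\<tau> x + - \<tau>' x) + (a - b)) + cos ((\<tau> x + \<tau>' x) + (a + b)))
          = cos (\<tau> x + a) * cos (\<tau>' x + b)"
        by (simp only: cos_add[of "\<tau> x + a"] cos_diff[of "\<tau> x + a"]) simp
    qed
    finally show ?case .
  next
    case (scale f c)
    from phase_functions.scale[OF scale.IH, of c] show ?case by (simp add: mult.left_commute)
  next
    case (add f g)
    from phase_functions.add[OF add.IH] show ?case by (simp add: distrib_left)
  qed
next
  case (scale f c)
  from phase_functions.scale[OF scale.IH, of c] show ?case by (simp add: mult.assoc)
next
  case (add f g)
  from phase_functions.add[OF add.IH] show ?case by (simp add: distrib_right)
qed

lemma clamp_error:
  fixes z y B :: real assumes "\<bar>y\<bar> \<le> B"
  shows "\<bar>y - max (- B) (min B z)\<bar> \<le> \<bar>y - z\<bar>"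
  using assms by (auto simp: max_def min_def)

text \<open>The Stone-Weierstrass theorem yields an approximation \<open>g\<close> on the compact set \<open>K\<close>, but nothing bounds \<open>g\<close>
  by the supremum of \<open>f\<close> outside \<open>K\<close>. As \<open>g\<close> is globally bounded by some constant, clamping to \<open>[-B, B]\<close>
  can be imitated on the range of \<open>g\<close> by a polynomial \<open>p\<close>; the function \<open>p \<circ> g\<close> still belongs to the span,
  which is an algebra.\<close>

lemma phase_functions_approximation:
  fixes L :: "('b::t2_space \<Rightarrow> real) set" and f :: "'b \<Rightarrow> real"
  assumes cont: "\<And>\<tau>. \<tau> \<in> L \<Longrightarrow> continuous_on UNIV \<tau>"
    and L: "\<And>\<tau> \<tau>'. \<tau> \<in> L \<Longrightarrow> \<tau>' \<in> L \<Longrightarrow> (\<lambda>x. \<tau> x + \<tau>' x) \<in> L" 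
      "\<And>c \<tau>. \<tau> \<in> L \<Longrightarrow> (\<lambda>x. c * \<tau> x) \<in> L" "L \<noteq> {}"
    and K: "compact K" and sep: "\<And>x y. x \<in> K \<Longrightarrow> y \<in> K \<Longrightarrow> x \<noteq> y \<Longrightarrow> \<exists>\<tau>\<in>L. \<tau> x \<noteq> \<tau> y"
    and f: "continuous_on UNIV f" "\<And>x. \<bar>f x\<bar> \<le> B" and e: "e > 0"
  shows "\<exists>h\<in>phase_functions L. (\<forall>x\<in>K. \<bar>f x - h x\<bar> < e) \<and> (\<forall>x. \<bar>h x\<bar> \<le> B + e)"
proof -
  let ?R = "phase_functions L"
  have mult_closed: "(\<lambda>x. f x * g x) \<in> ?R" if "f \<in> ?R" "g \<in> ?R" for f g
    using L(1) L(2)[of _ "-1"] that by (intro phase_functions_mult) auto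
  have const_mem: "(\<lambda>_. c) \<in> ?R" for c
  proof -
    obtain \<tau> where "\<tau> \<in> L" using L(3) by blast
    from phase_functions.scale[OF phase_functions.cosine[OF L(2)[OF this, of 0], of 0], of c]
    show ?thesis by simp
  qed
  have poly: "(\<lambda>x. p (g x)) \<in> ?R" if "real_polynomial_function p" "g \<in> ?R" for p :: "real \<Rightarrow> real" and g
    using that(1)
  proof (induction rule: real_polynomial_function.induct)
    case (linear l)
    have "(\<lambda>x. l (g x)) = (\<lambda>x. l 1 * g x)"
    proof
      show "l (g x) = l 1 * g x" for x
        using linear_scale[OF bounded_linear.linear[OF linear], of "g x" 1] by (simp add: mult.commute)
    qed
    thus ?case using phase_functions.scale[OF that(2), of "l 1"] by (simp only:)
  next
    case (const c)
    show ?case by (rule const_mem)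
  next
    case (add f h)
    show ?case by (rule phase_functions.add[OF add.IH])
  next
    case (mult f h)
    show ?case by (rule mult_closed[OF mult.IH])
  qed
  interpret R: function_ring_on ?R K
  proof
    fix x y assume xy: "x \<in> K" "y \<in> K" "x \<noteq> y"
    then obtain \<tau> where \<tau>: "\<tau> \<in> L" "\<tau> x \<noteq> \<tau> y" using sep[OF xy] by blast
    \<comment> \<open>Rescaling turns the difference of the phases into half a period, between whose ends the cosine drops from 1 to -1.\<close>
    define d where "d = \<tau> y - \<tau> x"
    have d: "d \<noteq> 0" using \<tau> by (simp add: d_def)
    have "cos (pi / d * \<tau> x + - (pi / d * \<tau> x)) \<noteq> cos (pi / d * \<tau> y + - (pi / d * \<tau> x))"
    proof -
      have "pi / d * \<tau> y + - (pi / d * \<tau> x) = pi / d * d" by (simp only: d_def right_diff_distrib)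
      also have "\<dots> = pi" using d by simp
      finally show ?thesis by simp
    qed
    thus "\<exists>f\<in>?R. f x \<noteq> f y"
      by (intro bexI[OF _ phase_functions.cosine[OF L(2)[OF \<tau>(1), of "pi / d"], of "- (pi / d * \<tau> x)"]])
  next
    fix f assume "f \<in> ?R"
    from phase_functions_continuous[OF cont this] show "continuous_on K f"
      by (rule continuous_on_subset) simp_all
  qed (use K mult_closed const_mem in \<open>auto intro: phase_functions.add\<close>)
  have "continuous_on K f" using f(1) continuous_on_subset by blast
  from R.Stone_Weierstrass_basic[OF this, of "e/2"] e obtain g where
    g: "g \<in> ?R" "\<And>x. x \<in> K \<Longrightarrow> \<bar>f x - g x\<bar> < e / 2" by auto
  obtain C where C: "\<And>x. \<bar>g x\<bar> \<le> C" using phase_functions_bounded[OF g(1)] by blast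
  obtain p where p: "real_polynomial_function p"
      "\<And>y. y \<in> {-C..C} \<Longrightarrow> \<bar>max (- B) (min B y) - p y\<bar> < e / 2"
  proof (rule Stone_Weierstrass_real_polynomial_function[of "{-C..C}" "\<lambda>y. max (- B) (min B y)" "e/2"])
    show "continuous_on {-C..C} (\<lambda>y. max (- B) (min B y))" by (intro continuous_intros)
  qed (use e in auto)
  have gC: "g x \<in> {-C..C}" for x using C[of x] by (simp add: abs_le_iff minus_le_iff)
  have B0: "0 \<le> B" using f(2)[of undefined] by linarith
  show ?thesis
  proof (intro bexI[OF _ poly[OF p(1) g(1)]] conjI ballI allI)
    fix x
    show "\<bar>p (g x)\<bar> \<le> B + e" using p(2)[OF gC[of x]] B0 e by (auto simp: max_def min_def abs_if split: if_splits)
    assume "x \<in> K"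
    from g(2)[OF this] clamp_error[OF f(2), of x "g x"] p(2)[OF gC[of x]]
    show "\<bar>f x - p (g x)\<bar> < e" by linarith
  qed
qed

lemma (in prob_space) integral_close_if_close_on_large_set:
  fixes f h :: "'a \<Rightarrow> real"
  assumes [measurable]: "f \<in> borel_measurable M" "h \<in> borel_measurable M" "K \<in> sets M"
    and fh: "\<And>x. \<bar>f x\<bar> \<le> B" "\<And>x. \<bar>h x\<bar> \<le> B + e" "\<And>x. x \<in> K \<Longrightarrow> \<bar>f x - h x\<bar> \<le> e"
    and K: "prob (space M - K) \<le> d" and "0 \<le> e"
  shows "\<bar>expectation f - expectation h\<bar> \<le> e + (2 * B + e) * d"
proof -
  have B: "0 \<le> B" using fh(1)[of undefined] by linarith
  have i: "integrable M f" "integrable M h"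
    using fh by (auto intro!: integrable_const_bound[of _ "B + e"] AE_I2 order_trans[OF fh(1)] simp: \<open>0 \<le> e\<close>)
  have "\<bar>expectation f - expectation h\<bar> \<le> expectation (\<lambda>x. \<bar>f x - h x\<bar>)"
    using i integral_abs_bound[of M "\<lambda>x. f x - h x"] by simp
  also have "\<dots> \<le> expectation (\<lambda>x. e + (2 * B + e) * indicator (space M - K) x)"
  proof (intro integral_mono)
    fix x assume x: "x \<in> space M"
    have "\<bar>f x - h x\<bar> \<le> 2 * B + e" using fh(1,2)[of x] by linarith
    thus "\<bar>f x - h x\<bar> \<le> e + (2 * B + e) * indicator (space M - K) x"
      using fh(3)[of x] x \<open>0 \<le> e\<close> by (auto simp: indicator_def)
  qed (use i in \<open>auto intro!: integrable_real_indicator simp: emeasure_eq_measure\<close>)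
  also have "\<dots> = e + (2 * B + e) * prob (space M - K)"
    by (subst Bochner_Integration.integral_add)
       (auto intro!: integrable_real_indicator simp: emeasure_eq_measure prob_space)
  also have "\<dots> \<le> e + (2 * B + e) * d" using K B \<open>0 \<le> e\<close> by (intro add_left_mono mult_left_mono) auto
  finally show ?thesis .
qed

text \<open>Convergence of the integrals passes from cosines to their span by linearity. An approximation of \<open>f\<close> from the
  span that is good on \<open>K\<close> and not much larger than \<open>f\<close> elsewhere then transfers it to \<open>f\<close>, since every measure
  involved puts little mass outside \<open>K\<close>.\<close>

lemma weakly_converges_if_phases_converge:
  fixes P :: "nat \<Rightarrow> 'b::t2_space measure" and L :: "('b \<Rightarrow> real) set"
  assumes P: "\<And>n. prob_space (P n)" "\<And>n. sets (P n) = sets borel" and Q: "prob_space Q" "sets Q = sets borel"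
    and cont: "\<And>\<tau>. \<tau> \<in> L \<Longrightarrow> continuous_on UNIV \<tau>"
    and L: "\<And>\<tau> \<tau>'. \<tau> \<in> L \<Longrightarrow> \<tau>' \<in> L \<Longrightarrow> (\<lambda>x. \<tau> x + \<tau>' x) \<in> L" 
      "\<And>c \<tau>. \<tau> \<in> L \<Longrightarrow> (\<lambda>x. c * \<tau> x) \<in> L" "L \<noteq> {}"
    and conv: "\<And>\<tau> a. \<tau> \<in> L \<Longrightarrow> (\<lambda>n. \<integral>x. cos (\<tau> x + a) \<partial>P n) \<longlonglongrightarrow> (\<integral>x. cos (\<tau> x + a) \<partial>Q)"
    and tight: "\<And>d. d > 0 \<Longrightarrow> \<exists>K. compact K \<and> (\<forall>x\<in>K. \<forall>y\<in>K. x \<noteq> y \<longrightarrow> (\<exists>\<tau>\<in>L. \<tau> x \<noteq> \<tau> y))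
        \<and> (\<forall>n. measure (P n) (- K) \<le> d) \<and> measure Q (- K) \<le> d"
  shows "weakly_converges P Q"
  unfolding weakly_converges_def
proof (intro allI impI)
  fix f :: "'b \<Rightarrow> real" assume "continuous_on UNIV f \<and> bounded (range f)"
  then obtain B where f: "continuous_on UNIV f" "\<And>x. \<bar>f x\<bar> \<le> B" by (auto simp: bounded_iff)
  have B: "0 \<le> B" using f(2)[of undefined] by linarith
  have mP: "g \<in> borel_measurable (P n)" and mQ: "g \<in> borel_measurable Q"
    if "continuous_on UNIV g" for g :: "'b \<Rightarrow> real" and n
    using borel_measurable_continuous_onI[OF that] measurable_cong_sets[OF P(2) refl] measurable_cong_sets[OF Q(2) refl] by blast+
  have hconv: "(\<lambda>n. integral\<^sup>L (P n) h) \<longlonglongrightarrow> integral\<^sup>L Q h" if "h \<in> phase_functions L" for h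
    using that
  proof (induction rule: phase_functions.induct)
    case (cosine \<tau> a) thus ?case by (rule conv)
  next
    case (scale g c) thus ?case by (auto intro!: tendsto_intros)
  next
    case (add g g')
    have i: "integrable (P n) h" "integrable Q h" if h: "h \<in> phase_functions L" for h n
    proof -
      obtain C where "\<And>x. \<bar>h x\<bar> \<le> C" using phase_functions_bounded[OF h] by blast
      thus "integrable (P n) h" "integrable Q h"
        using mP[OF phase_functions_continuous[OF cont h]] mQ[OF phase_functions_continuous[OF cont h]]
        by (auto intro!: finite_measure.integrable_const_bound[where B=C] prob_space.finite_measure P Q)
    qed
    show ?case using add i by (auto intro!: tendsto_intros)
  qed
  show "(\<lambda>n. integral\<^sup>L (P n) f) \<longlonglongrightarrow> integral\<^sup>L Q f"
  proof (rule LIMSEQ_I)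
    fix r :: real assume r: "r > 0"
    define e where "e = min 1 (r / 8)"
    define d where "d = r / (8 * (2 * B + 1))"
    \<comment> \<open>The choices make \<open>e + (2 * B + e) * d\<close>, the error of replacing \<open>f\<close> by \<open>h\<close> under one measure, at most \<open>r / 4\<close>.\<close>
    have e: "0 < e" "e \<le> 1" "e \<le> r / 8" and d: "0 < d" "(2 * B + 1) * d = r / 8"
      using r B by (simp_all add: e_def d_def field_simps)
    obtain K where K: "compact K" "\<And>x y. x \<in> K \<Longrightarrow> y \<in> K \<Longrightarrow> x \<noteq> y \<Longrightarrow> \<exists>\<tau>\<in>L. \<tau> x \<noteq> \<tau> y"
      "\<And>n. measure (P n) (- K) \<le> d" "measure Q (- K) \<le> d" using tight[OF d(1)] by metis
    obtain h where h: "h \<in> phase_functions L" "\<And>x. x \<in> K \<Longrightarrow> \<bar>f x - h x\<bar> < e" "\<And>x. \<bar>h x\<bar> \<le> B + e"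
      using phase_functions_approximation[OF cont L K(1,2) f e(1)] by blast
    have hc: "continuous_on UNIV h" using phase_functions_continuous[OF cont h(1)] .
    have Kb: "K \<in> sets borel" using K(1) by (intro borel_closed compact_imp_closed)
    have small: "e + (2 * B + e) * d \<le> r / 4"
    proof -
      have "(2 * B + e) * d \<le> (2 * B + 1) * d" using e d by (intro mult_right_mono) auto
      thus ?thesis using e d by linarith
    qed
    have sp: "space (P n) = UNIV" "space Q = UNIV" for n
      using sets_eq_imp_space_eq[OF P(2)] sets_eq_imp_space_eq[OF Q(2)] by auto
    have cP: "\<bar>integral\<^sup>L (P n) f - integral\<^sup>L (P n) h\<bar> \<le> r / 4" for n
      using K(3)[of n] h e(1) f(2) Kb P(2)[of n] order_less_imp_le[OF h(2)]
      by (intro order_trans[OF prob_space.integral_close_if_close_on_large_set[OF P(1) mP[OF f(1)] mP[OF hc], of K] small])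
         (auto simp: sp Compl_eq_Diff_UNIV[symmetric])
    have cQ: "\<bar>integral\<^sup>L Q f - integral\<^sup>L Q h\<bar> \<le> r / 4"
      using K(4) h e(1) f(2) Kb Q(2) order_less_imp_le[OF h(2)]
      by (intro order_trans[OF prob_space.integral_close_if_close_on_large_set[OF Q(1) mQ[OF f(1)] mQ[OF hc], of K] small])
         (auto simp: sp Compl_eq_Diff_UNIV[symmetric])
    obtain N where N: "\<And>n. n \<ge> N \<Longrightarrow> \<bar>integral\<^sup>L (P n) h - integral\<^sup>L Q h\<bar> < r / 4"
      using LIMSEQ_D[OF hconv[OF h(1)], of "r/4"] r by auto
    show "\<exists>no. \<forall>n\<ge>no. norm (integral\<^sup>L (P n) f - integral\<^sup>L Q f) < r"
    proof (intro exI[of _ N] allI impI)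
      fix n assume "n \<ge> N"
      from N[OF this] cQ cP[of n] r show "norm (integral\<^sup>L (P n) f - integral\<^sup>L Q f) < r"
        unfolding real_norm_def by linarith
    qed
  qed
qed

text \<open>Markov's inequality. The set \<open>S\<close> carries the measure, so only the part of \<open>K\<close> inside \<open>S\<close> matters; this is how
  a ball that is compact only within a closed subset can witness tightness.\<close>

lemma (in prob_space) prob_outside_ball_le_second_moment:
  fixes N :: "'a \<Rightarrow> real"
  assumes N: "integrable M N" "\<And>x. 0 \<le> N x" "expectation N \<le> c" and R: "0 < R"
    and K[measurable]: "K \<in> events" and S: "AE x in M. x \<in> S" "{x \<in> S. N x \<le> R} \<subseteq> K"
  shows "prob (space M - K) \<le> c / R"
proof -
  have [measurable]: "random_variable borel N" using N(1) by (rule borel_measurable_integrable)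
  have "prob (space M - K) \<le> prob {x \<in> space M. R \<le> N x}"
  proof (rule finite_measure_mono_AE)
    show "AE x in M. x \<in> space M - K \<longrightarrow> x \<in> {x \<in> space M. R \<le> N x}"
      using S(1) by eventually_elim (use S(2) in auto)
  qed measurable
  also have "\<dots> \<le> expectation N / R"
    using integral_Markov_inequality_measure[OF N(1), of "{}" R] N(2) R by simp
  also have "\<dots> \<le> c / R" using N(3) R by (simp add: divide_right_mono)
  finally show ?thesis .
qed

text \<open>The coordinates \<open>p j\<close> generate the phases, and they separate the points of the set \<open>S\<close> that carries all the
  measures. A bound on the expected squared length gives tightness, because the balls of \<open>S\<close> are compact.\<close>

theorem weakly_converges_if_linear_phases_converge:
  fixes P :: "nat \<Rightarrow> 'b::t2_space measure" and p :: "'j \<Rightarrow> 'b \<Rightarrow> real"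
  assumes P: "\<And>n. prob_space (P n)" "\<And>n. sets (P n) = sets borel"
    and Q: "prob_space Q" "sets Q = sets borel"
    and p: "\<And>j. continuous_on UNIV (p j)"
    and S: "\<And>R. compact {x \<in> S. (\<Sum>j\<in>J. (p j x)\<^sup>2) \<le> R}"
      "\<And>x y. x \<in> S \<Longrightarrow> y \<in> S \<Longrightarrow> (\<And>j. j \<in> J \<Longrightarrow> p j x = p j y) \<Longrightarrow> x = y"
    and J: "finite J"
    and PS: "\<And>n. AE x in P n. x \<in> S" and QS: "AE x in Q. x \<in> S"
    and P2: "\<And>n. integrable (P n) (\<lambda>x. \<Sum>j\<in>J. (p j x)\<^sup>2)" "\<And>n. (\<integral>x. (\<Sum>j\<in>J. (p j x)\<^sup>2) \<partial>P n) \<le> c"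
    and Q2: "integrable Q (\<lambda>x. \<Sum>j\<in>J. (p j x)\<^sup>2)" "(\<integral>x. (\<Sum>j\<in>J. (p j x)\<^sup>2) \<partial>Q) \<le> c"
    and conv: "\<And>t a. (\<lambda>n. \<integral>x. cos ((\<Sum>j\<in>J. t j * p j x) + a) \<partial>P n)
        \<longlonglongrightarrow> (\<integral>x. cos ((\<Sum>j\<in>J. t j * p j x) + a) \<partial>Q)"
  shows "weakly_converges P Q"
proof (rule weakly_converges_if_phases_converge[where L = "range (\<lambda>t x. \<Sum>j\<in>J. t j * p j x)"])
  let ?L = "range (\<lambda>t x. \<Sum>j\<in>J. t j * p j x)"
  show "(\<lambda>x. \<tau> x + \<tau>' x) \<in> ?L" if "\<tau> \<in> ?L" "\<tau>' \<in> ?L" for \<tau> \<tau>'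
  proof -
    from that obtain t t' where "\<tau> = (\<lambda>x. \<Sum>j\<in>J. t j * p j x)" "\<tau>' = (\<lambda>x. \<Sum>j\<in>J. t' j * p j x)" by auto
    thus ?thesis by (intro range_eqI[of _ _ "\<lambda>j. t j + t' j"]) (simp add: distrib_right sum.distrib)
  qed
  show "(\<lambda>x. k * \<tau> x) \<in> ?L" if "\<tau> \<in> ?L" for k \<tau>
  proof -
    from that obtain t where "\<tau> = (\<lambda>x. \<Sum>j\<in>J. t j * p j x)" by auto
    thus ?thesis by (intro range_eqI[of _ _ "\<lambda>j. k * t j"]) (simp add: sum_distrib_left mult.assoc)
  qed
  show "continuous_on UNIV \<tau>" if "\<tau> \<in> ?L" for \<tau> using that p by (auto intro!: continuous_intros)
  show "(\<lambda>n. \<integral>x. cos (\<tau> x + a) \<partial>P n) \<longlonglongrightarrow> (\<integral>x. cos (\<tau> x + a) \<partial>Q)" if "\<tau> \<in> ?L" for \<tau> a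
    using that conv by auto
  fix d :: real assume d: "0 < d"
  \<comment> \<open>Markov's inequality needs \<open>c / R \<le> d\<close>; adding 1 keeps the radius positive when \<open>c = 0\<close>.\<close>
  define R where "R = (\<bar>c\<bar> + 1) / d"
  have R: "0 < R" "c / R \<le> d" using d by (auto simp: R_def divide_simps abs_if mult_ac)
  let ?K = "{x \<in> S. (\<Sum>j\<in>J. (p j x)\<^sup>2) \<le> R}"
  have K: "?K \<in> sets borel" by (intro borel_closed compact_imp_closed S)
  have sep: "\<exists>\<tau>\<in>?L. \<tau> x \<noteq> \<tau> y" if "x \<in> ?K" "y \<in> ?K" "x \<noteq> y" for x y
  proof -
    obtain j where "j \<in> J" "p j x \<noteq> p j y" using S(2) \<open>x \<in> ?K\<close> \<open>y \<in> ?K\<close> \<open>x \<noteq> y\<close> by blast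
    thus ?thesis using J
      by (intro bexI[of _ "\<lambda>x. \<Sum>i\<in>J. (if i = j then 1 else 0) * p i x"] range_eqI[of _ _ "\<lambda>i. if i = j then 1 else 0"])
         (simp_all add: if_distrib[of "\<lambda>u. u * _"] sum.delta cong: if_cong)
  qed
  have small: "measure T (- ?K) \<le> d" if "prob_space T" "sets T = sets borel" "AE x in T. x \<in> S"
    "integrable T (\<lambda>x. \<Sum>j\<in>J. (p j x)\<^sup>2)" "(\<integral>x. (\<Sum>j\<in>J. (p j x)\<^sup>2) \<partial>T) \<le> c" for T
  proof -
    have "measure T (space T - ?K) \<le> c / R"
      by (rule prob_space.prob_outside_ball_le_second_moment[OF that(1) that(4) _ that(5) R(1) _ that(3)])
         (use K that(2) in \<open>auto intro: sum_nonneg\<close>)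
    thus ?thesis using R(2) sets_eq_imp_space_eq[OF that(2)] by (simp add: Compl_eq_Diff_UNIV)
  qed
  show "\<exists>K. compact K \<and> (\<forall>x\<in>K. \<forall>y\<in>K. x \<noteq> y \<longrightarrow> (\<exists>\<tau>\<in>?L. \<tau> x \<noteq> \<tau> y))
        \<and> (\<forall>n. measure (P n) (- K) \<le> d) \<and> measure Q (- K) \<le> d"
  proof (intro exI[of _ ?K] conjI ballI impI allI)
    show "compact ?K" by (rule S)
    show "measure (P n) (- ?K) \<le> d" for n by (rule small[OF P PS P2])
    show "measure Q (- ?K) \<le> d" by (rule small[OF Q QS Q2])
    show "\<exists>\<tau>\<in>?L. \<tau> x \<noteq> \<tau> y" if "x \<in> ?K" "y \<in> ?K" "x \<noteq> y" for x y by (rule sep[OF that])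
  qed
qed (use P Q in auto)

lemma (in prob_space) expectation_cos_eq_Re_iexp:
  assumes [measurable]: "random_variable borel Y"
  shows "expectation (\<lambda>\<omega>. cos (Y \<omega> + a)) = Re (iexp a * expectation (\<lambda>\<omega>. iexp (Y \<omega>)))"
proof -
  have "integrable M (\<lambda>\<omega>. iexp (Y \<omega>))" by (rule integrable_const_bound[of _ 1]) auto
  hence "Re (expectation (\<lambda>\<omega>. iexp a * iexp (Y \<omega>))) = expectation (\<lambda>\<omega>. Re (iexp a * iexp (Y \<omega>)))"
    by (intro integral_Re[symmetric]) simp
  moreover have "Re (iexp a * iexp (Y \<omega>)) = cos (Y \<omega> + a)" for \<omega>
    unfolding exp_add[symmetric] distrib_left[symmetric] of_real_add[symmetric]
    by (simp add: Re_exp add.commute)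
  ultimately show ?thesis by simp
qed

section \<open>Standard normal vectors\<close>

abbreviation std_normal_vector :: "'i set \<Rightarrow> ('i \<Rightarrow> real) measure" where
  "std_normal_vector I \<equiv> PiM I (\<lambda>_. std_normal_distribution)"

lemma prob_space_std_normal: "prob_space std_normal_distribution"
  using real_dist_normal_dist by (simp add: real_distribution_def)

lemma prob_space_std_normal_vector: "prob_space (std_normal_vector I)"
  by (intro prob_space_PiM prob_space_std_normal)

lemma product_prob_space_std_normal: "product_prob_space (\<lambda>_. std_normal_distribution)"
  by (simp add: product_prob_space_def product_prob_space_axioms_def product_sigma_finite_def
      prob_space_std_normal prob_space_imp_sigma_finite)

lemmas product_sigma_finite_std_normal = product_prob_space.axioms(1)[OF product_prob_space_std_normal]

lemma sets_std_normal_vector[measurable_cong]: "sets (std_normal_vector I) = sets (PiM I (\<lambda>_. borel))"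
  by (intro sets_PiM_cong) auto

lemma characteristic_std_normal_vector:
  assumes I: "finite I"
  shows "(\<integral>z. iexp (\<Sum>i\<in>I. t i * z i) \<partial>std_normal_vector I) = exp (- (\<Sum>i\<in>I. (t i)\<^sup>2) / 2)"
proof -
  have "(\<integral>z. iexp (\<Sum>i\<in>I. t i * z i) \<partial>std_normal_vector I) = (\<integral>z. (\<Prod>i\<in>I. iexp (t i * z i)) \<partial>std_normal_vector I)"
    using I by (simp add: exp_sum sum_distrib_left)
  also have "\<dots> = (\<Prod>i\<in>I. (\<integral>x. iexp (t i * x) \<partial>std_normal_distribution))"
  proof (rule product_sigma_finite.product_integral_prod[OF product_sigma_finite_std_normal I])
    show "integrable std_normal_distribution (\<lambda>x. iexp (t i * x))" for i
      by (rule finite_measure.integrable_const_bound[of _ _ 1])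
         (auto intro: prob_space.finite_measure prob_space_std_normal)
  qed
  also have "\<dots> = (\<Prod>i\<in>I. complex_of_real (exp (- (t i)\<^sup>2 / 2)))"
    using char_std_normal_distribution by (simp add: char_def fun_eq_iff)
  also have "\<dots> = exp (- (\<Sum>i\<in>I. (t i)\<^sup>2) / 2)"
    using I by (simp add: exp_sum[symmetric] of_real_prod[symmetric] sum_divide_distrib sum_negf del: of_real_prod)
  finally show ?thesis .
qed

lemma second_moment_std_normal_vector:
  assumes i: "i \<in> I"
  shows "integrable (std_normal_vector I) (\<lambda>z. (z i)\<^sup>2)" "(\<integral>z. (z i)\<^sup>2 \<partial>std_normal_vector I) = 1"
proof -
  have D: "distr (std_normal_vector I) std_normal_distribution (\<lambda>z. z i) = std_normal_distribution"
    by (rule product_prob_space.PiM_component[OF product_prob_space_std_normal i])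
  have m: "(\<lambda>z. z i) \<in> std_normal_vector I \<rightarrow>\<^sub>M std_normal_distribution"
    using measurable_component_singleton[OF i] .
  have "integrable (distr (std_normal_vector I) std_normal_distribution (\<lambda>z. z i)) (\<lambda>x. x\<^sup>2)"
    unfolding D by (rule integrable_std_normal_distribution_moment)
  thus "integrable (std_normal_vector I) (\<lambda>z. (z i)\<^sup>2)" by (rule integrable_distr[OF m])
  have "(\<integral>z. (z i)\<^sup>2 \<partial>std_normal_vector I) = (\<integral>x. x\<^sup>2 \<partial>distr (std_normal_vector I) std_normal_distribution (\<lambda>z. z i))"
    by (rule integral_distr[symmetric, OF m]) simp
  also have "\<dots> = 1" unfolding D using std_normal_distribution_even_moments(1)[of 1] by simp
  finally show "(\<integral>z. (z i)\<^sup>2 \<partial>std_normal_vector I) = 1" .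
qed

text \<open>Identifies the product of normal laws with the multivariate normal density: both give a box the product of the
  one-dimensional probabilities, by Fubini's theorem.\<close>

lemma std_normal_vector_eq_density:
  assumes I: "finite I"
  shows "std_normal_vector I = density (PiM I (\<lambda>_. lborel)) (\<lambda>z. \<Prod>i\<in>I. ennreal (std_normal_density (z i)))"
proof (rule product_sigma_finite.PiM_eqI[OF product_sigma_finite_std_normal I, symmetric])
  interpret L: product_sigma_finite "\<lambda>_::'a. lborel :: real measure" ..
  have [measurable_cong]: "sets (PiM I (\<lambda>_. lborel :: real measure)) = sets (PiM I (\<lambda>_. borel))"
    by (intro sets_PiM_cong) auto
  show "sets (density (PiM I (\<lambda>_. lborel)) (\<lambda>z. \<Prod>i\<in>I. ennreal (std_normal_density (z i)))) = sets (std_normal_vector I)"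
    unfolding sets_std_normal_vector by (auto intro!: sets_PiM_cong)
  fix A :: "'a \<Rightarrow> real set" assume "\<And>i. i \<in> I \<Longrightarrow> A i \<in> sets std_normal_distribution"
  hence A[measurable]: "\<And>i. i \<in> I \<Longrightarrow> A i \<in> sets borel" by simp
  have AE: "PiE I A \<in> sets (PiM I (\<lambda>_. lborel))" using A I by (intro sets_PiM_I_finite) auto
  have "emeasure (density (PiM I (\<lambda>_. lborel)) (\<lambda>z. \<Prod>i\<in>I. ennreal (std_normal_density (z i)))) (PiE I A)
      = (\<integral>\<^sup>+z. (\<Prod>i\<in>I. ennreal (std_normal_density (z i))) * indicator (PiE I A) z \<partial>PiM I (\<lambda>_. lborel))"
    by (rule emeasure_density[OF _ AE]) measurable
  also have "\<dots> = (\<integral>\<^sup>+z. (\<Prod>i\<in>I. ennreal (std_normal_density (z i)) * indicator (A i) (z i)) \<partial>PiM I (\<lambda>_. lborel))"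
  proof (rule nn_integral_cong)
    fix z assume "z \<in> space (PiM I (\<lambda>_. lborel :: real measure))"
    hence "z \<in> extensional I" by (auto simp: space_PiM PiE_def)
    hence "indicator (PiE I A) z = (\<Prod>i\<in>I. indicator (A i) (z i) :: ennreal)"
      using I by (auto simp: indicator_def PiE_iff prod_zero_iff)
    thus "(\<Prod>i\<in>I. ennreal (std_normal_density (z i))) * indicator (PiE I A) z
        = (\<Prod>i\<in>I. ennreal (std_normal_density (z i)) * indicator (A i) (z i))"
      by (simp add: prod.distrib)
  qed
  also have "\<dots> = (\<Prod>i\<in>I. \<integral>\<^sup>+x. ennreal (std_normal_density x) * indicator (A i) x \<partial>lborel)"
    using A by (intro L.product_nn_integral_prod[OF I, of "\<lambda>i x. ennreal (std_normal_density x) * indicator (A i) x"]) simp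
  also have "\<dots> = (\<Prod>i\<in>I. emeasure std_normal_distribution (A i))"
    by (intro prod.cong refl) (simp add: emeasure_density A)
  finally show "emeasure (density (PiM I (\<lambda>_. lborel)) (\<lambda>z. \<Prod>i\<in>I. ennreal (std_normal_density (z i)))) (PiE I A)
    = (\<Prod>i\<in>I. emeasure std_normal_distribution (A i))" .
qed

lemma matrix_inv_mat_1: "matrix_inv (mat 1 :: real ^ 's ^ 's) = mat 1"
  unfolding matrix_inv_def by (rule some_equality) auto

text \<open>Lebesgue measure on Euclidean space is itself the image of a product measure indexed by the basis, and
  \<open>x \<bullet> x\<close> is the sum of the squared coordinates, so the normal density factorises.\<close>

lemma standard_normal_distribution_eq:
  "normal_distribution (0 :: real ^ 's) (mat 1)
    = distr (std_normal_vector Basis) borel (\<lambda>f. \<Sum>b\<in>Basis. f b *\<^sub>R b)"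
proof -
  let ?s = "\<lambda>f. \<Sum>b\<in>Basis. f b *\<^sub>R b :: real ^ 's"
  let ?h = "\<lambda>x :: real ^ 's. ennreal (exp (- (x \<bullet> x) / 2) / sqrt ((2 * pi) ^ CARD('s)))"
  have "normal_distribution (0 :: real ^ 's) (mat 1) = density lborel ?h"
    by (simp add: normal_distribution_def matrix_inv_mat_1 det_I)
  also have "\<dots> = distr (density (PiM Basis (\<lambda>_. lborel)) (\<lambda>f. ?h (?s f))) borel ?s"
    by (subst lborel_eq, rule density_distr) measurable
  also have "density (PiM Basis (\<lambda>_. lborel)) (\<lambda>f. ?h (?s f)) = std_normal_vector Basis"
  proof -
    have "?h (?s f) = (\<Prod>b\<in>(Basis :: (real ^ 's) set). ennreal (std_normal_density (f b)))" for f
    proof -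
      have "?s f \<bullet> ?s f = (\<Sum>b\<in>Basis. (f b)\<^sup>2)"
        by (subst euclidean_inner) (simp add: power2_eq_square)
      moreover have "sqrt ((2 * pi) ^ CARD('s)) = (\<Prod>b\<in>(Basis :: (real ^ 's) set). sqrt (2 * pi))"
        by (simp only: real_sqrt_power prod_constant DIM_cart DIM_real mult_1_right)
      moreover have "- (\<Sum>b\<in>(Basis :: (real ^ 's) set). (f b)\<^sup>2) / 2 = (\<Sum>b\<in>(Basis :: (real ^ 's) set). - (f b)\<^sup>2 / 2)"
        by (simp add: sum_divide_distrib[symmetric] sum_negf)
      ultimately have "exp (- (?s f \<bullet> ?s f) / 2) / sqrt ((2 * pi) ^ CARD('s)) = (\<Prod>b\<in>(Basis :: (real ^ 's) set). exp (- (f b)\<^sup>2 / 2) / sqrt (2 * pi))"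
        by (simp only: prod_dividef exp_sum[symmetric] finite_Basis)
      also have "\<dots> = (\<Prod>b\<in>(Basis :: (real ^ 's) set). std_normal_density (f b))"
        by (simp add: normal_density_def)
      finally have "exp (- (?s f \<bullet> ?s f) / 2) / sqrt ((2 * pi) ^ CARD('s)) = (\<Prod>b\<in>(Basis :: (real ^ 's) set). std_normal_density (f b))" .
      thus ?thesis by (simp add: prod_ennreal)
    qed
    thus ?thesis by (simp add: std_normal_vector_eq_density)
  qed
  finally show ?thesis .
qed

section \<open>Vanishing parameters make the chain independent\<close>

lemma emeasure_lborel_unit_square: "emeasure lborel unit_square = 1"
  unfolding lborel_prod[symmetric] by (subst lborel.emeasure_pair_measure_Times) auto

text \<open>Each partial sum is the constant 1, so the \<open>L\<^sup>2\<close> distance of \<open>c\<close> to 1 vanishes. To conclude from a vanishing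
  integral, \<open>(c - 1)\<^sup>2\<close> has to be integrable, which follows from \<open>(c - 1)\<^sup>2 \<le> 2 c\<^sup>2 + 2\<close>.\<close>

lemma density_eq_one_if_coefficients_vanish:
  assumes c: "square_integrable_copula C c" and series: "sine_cosine_series c lam mu"
    and zero: "\<forall>k\<ge>1. lam k = 0 \<and> mu k = 0"
  shows "AE p in lborel. p \<in> unit_square \<longrightarrow> c (fst p) (snd p) = 1"
proof -
  define d where "d = (\<lambda>(u, v). c u v)"
  have [measurable]: "d \<in> borel_measurable borel"
    using c by (simp add: d_def square_integrable_copula_def copula_density_def)
  have [measurable]: "unit_square \<in> sets borel" by (simp add: borel_open open_Times)
  have "set_integrable lborel unit_square (\<lambda>p. (d p)\<^sup>2)"
    using c by (simp add: d_def square_integrable_copula_def case_prod_unfold)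
  moreover have "set_integrable lborel unit_square (\<lambda>p. 1 :: real)"
    unfolding set_integrable_def by (simp add: emeasure_lborel_unit_square)
  ultimately have dom: "integrable lborel (\<lambda>p. indicator unit_square p *\<^sub>R (2 * (d p)\<^sup>2 + 2 * 1))"
    unfolding set_integrable_def[symmetric] by (intro set_integral_add set_integrable_mult_right) auto
  have int: "integrable lborel (\<lambda>p. indicator unit_square p *\<^sub>R (d p - 1)\<^sup>2)"
  proof (rule Bochner_Integration.integrable_bound[OF dom])
    have "(d p - 1)\<^sup>2 \<le> 2 * (d p)\<^sup>2 + 2 * 1" for p
      using zero_le_power2[of "d p + 1"] by (simp add: power2_eq_square algebra_simps)
    thus "AE p in lborel. norm (indicator unit_square p *\<^sub>R (d p - 1)\<^sup>2)
        \<le> norm (indicator unit_square p *\<^sub>R (2 * (d p)\<^sup>2 + 2 * 1))"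
      by (intro AE_I2) (auto simp: indicator_def abs_of_nonneg)
  qed measurable
  have "sine_cosine_partial_sum lam mu N u v = 1" for N u v
    using zero by (simp add: sine_cosine_partial_sum_def)
  hence "(\<lambda>N::nat. LINT p:unit_square|lborel. (d p - 1)\<^sup>2) \<longlonglongrightarrow> 0"
    using series by (simp add: sine_cosine_series_def d_def case_prod_unfold)
  hence "(LINT p:unit_square|lborel. (d p - 1)\<^sup>2) = 0" by (simp add: LIMSEQ_const_iff)
  hence "AE p in lborel. indicator unit_square p *\<^sub>R (d p - 1)\<^sup>2 = 0"
    using int by (subst (asm) set_lebesgue_integral_def) (subst (asm) integral_nonneg_eq_0_iff_AE, auto)
  thus ?thesis by eventually_elim (auto simp: d_def case_prod_unfold)
qed

lemma copula_is_product_if_density_eq_one: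
  assumes C: "copula_density C c"
    and one: "AE p in lborel. p \<in> unit_square \<longrightarrow> c (fst p) (snd p) = 1"
  shows "C u v = measure (uniform_measure lborel {0<..<1}) {..u} * measure (uniform_measure lborel {0<..<1}) {..v}"
proof -
  have S[measurable]: "unit_square \<in> sets borel" by (simp add: borel_open open_Times)
  have [measurable]: "(\<lambda>(u, v). c u v) \<in> borel_measurable borel" using C by (simp add: copula_density_def)
  have "density lborel (\<lambda>(x, y). indicator unit_square (x, y) * ennreal (c x y)) = density lborel (indicator unit_square)"
  proof (rule density_cong)
    have "(\<lambda>p. indicator unit_square p * ennreal ((\<lambda>(u, v). c u v) p)) \<in> borel_measurable lborel"
      by measurable
    thus "(\<lambda>(x, y). indicator unit_square (x, y) * ennreal (c x y)) \<in> borel_measurable lborel"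
      by (simp add: case_prod_unfold)
    show "AE x in lborel. (case x of (x, y) \<Rightarrow> indicator unit_square (x, y) * ennreal (c x y)) = indicator unit_square x"
      using one by eventually_elim (auto simp: indicator_def)
  qed measurable
  hence "C u v = measure (density lborel (indicator unit_square)) ({..u} \<times> {..v})"
    using C by (simp add: copula_density_def)
  also have "\<dots> = measure lborel (({0<..<1} \<inter> {..u}) \<times> ({0<..<1} \<inter> {..v}))"
  proof -
    have "emeasure (density lborel (indicator unit_square)) ({..u} \<times> {..v}) = emeasure lborel (unit_square \<inter> {..u} \<times> {..v})"
      by (subst emeasure_density) (auto simp: indicator_inter_arith[symmetric] borel_closed closed_Times)
    also have "unit_square \<inter> {..u} \<times> {..v} = ({0<..<1} \<inter> {..u}) \<times> ({0<..<1} \<inter> {..v})" by auto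
    finally show ?thesis by (simp add: measure_def)
  qed
  also have "\<dots> = measure lborel ({0<..<1} \<inter> {..u}) * measure lborel ({0<..<1} \<inter> {..v})"
    unfolding lborel_prod[symmetric] measure_def
    by (subst lborel.emeasure_pair_measure_Times) (auto simp: enn2real_mult)
  finally show ?thesis
    by (simp add: measure_def emeasure_uniform_measure divide_ennreal_def)
qed

context prob_space begin

text \<open>The half-lines form an intersection-stable generator of the Borel sets, so independence extends from them to
  the generated sigma-algebras.\<close>

lemma indep_var_if_joint_cdf_factors:
  fixes X Y :: "'a \<Rightarrow> real"
  assumes [measurable]: "random_variable borel X" "random_variable borel Y"
    and cdf: "\<And>u v. prob {\<omega> \<in> space M. X \<omega> \<le> u \<and> Y \<omega> \<le> v}
      = prob {\<omega> \<in> space M. X \<omega> \<le> u} * prob {\<omega> \<in> space M. Y \<omega> \<le> v}"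
  shows "indep_var borel X borel Y"
proof -
  define G where "G Z = {Z -` A \<inter> space M | A. A \<in> range atMost}" for Z :: "'a \<Rightarrow> real"
  have gen: "sigma_sets (space M) {Z -` A \<inter> space M | A. A \<in> sets borel} = sigma_sets (space M) (G Z)" for Z :: "'a \<Rightarrow> real"
  proof -
    have "sets (borel :: real measure) = sigma_sets UNIV (range atMost)"
      by (subst borel_eq_atMost) (simp add: atMost_def)
    hence "{Z -` A \<inter> space M | A. A \<in> sets borel} = sigma_sets (space M) (G Z)"
      unfolding G_def using sigma_sets_vimage_commute[of Z "space M" UNIV "range atMost"] by simp
    moreover have "G Z \<subseteq> Pow (space M)" by (auto simp: G_def)
    ultimately show ?thesis by (simp add: sigma_sets_sigma_sets_eq)
  qed
  have stable: "Int_stable (G Z)" for Z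
  proof (rule Int_stableI)
    fix a b assume "a \<in> G Z" "b \<in> G Z"
    then obtain x y where "a = Z -` {..x} \<inter> space M" "b = Z -` {..y} \<inter> space M" by (auto simp: G_def)
    hence "a \<inter> b = Z -` {..min x y} \<inter> space M" by auto
    thus "a \<inter> b \<in> G Z" unfolding G_def by blast
  qed
  have "indep_set (G X) (G Y)"
  proof (rule indep_setI)
    fix a b assume "a \<in> G X" "b \<in> G Y"
    then obtain x y where ab: "a = X -` {..x} \<inter> space M" "b = Y -` {..y} \<inter> space M" by (auto simp: G_def)
    hence "a = {\<omega> \<in> space M. X \<omega> \<le> x}" "b = {\<omega> \<in> space M. Y \<omega> \<le> y}"
      "a \<inter> b = {\<omega> \<in> space M. X \<omega> \<le> x \<and> Y \<omega> \<le> y}" by auto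
    thus "prob (a \<inter> b) = prob a * prob b" using cdf by simp
  qed (auto simp: G_def)
  hence "indep_set (sigma_sets (space M) (G X)) (sigma_sets (space M) (G Y))"
    by (rule indep_set_sigma_sets[OF _ stable stable])
  thus ?thesis unfolding indep_var_eq gen by simp
qed

text \<open>Both sides say that the constant \<open>P (Y \<in> A)\<close> has the integrals over sets of \<open>F\<close> that characterise the
  conditional expectation. The equivalence is used in both directions: from independence of neighbours to the
  conditional expectation, and back after the Markov property has enlarged the conditioning.\<close>

lemma cond_exp_indicator_const_iff_indep:
  assumes F: "subalgebra M F" and [measurable]: "random_variable N Y" "A \<in> sets N"
  shows "(AE \<omega> in M. real_cond_exp M F (\<lambda>\<omega>. indicator A (Y \<omega>)) \<omega> = prob (Y -` A \<inter> space M))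
    \<longleftrightarrow> (\<forall>a\<in>sets F. prob (a \<inter> (Y -` A \<inter> space M)) = prob a * prob (Y -` A \<inter> space M))"
    (is "?const \<longleftrightarrow> ?indep")
proof -
  interpret finite_measure_subalgebra M F using F by unfold_locales
  let ?E = "Y -` A \<inter> space M"
  have aM: "a \<in> events" if "a \<in> sets F" for a using F that by (auto simp: subalgebra_def)
  have int: "integrable M (\<lambda>\<omega>. indicator A (Y \<omega>) :: real)"
    by (rule integrable_const_bound[of _ 1]) auto
  have lhs: "(LINT \<omega>:a|M. indicator A (Y \<omega>)) = prob (a \<inter> ?E)" if "a \<in> sets F" for a
  proof -
    have "(LINT \<omega>:a|M. (indicator A (Y \<omega>) :: real)) = (LINT \<omega>|M. indicator (a \<inter> ?E) \<omega>)"
      unfolding set_lebesgue_integral_def by (intro Bochner_Integration.integral_cong) (auto simp: indicator_def)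
    also have "\<dots> = prob (a \<inter> ?E)" using aM[OF that] by simp
    finally show ?thesis .
  qed
  have rhs: "(LINT \<omega>:a|M. prob ?E) = prob a * prob ?E" if "a \<in> sets F" for a
    unfolding set_lebesgue_integral_def using aM[OF that] sets.sets_into_space[OF aM[OF that]] by (simp add: Int_absorb2)
  show ?thesis
  proof
    assume c: ?const
    show ?indep
    proof
      fix a assume a: "a \<in> sets F"
      have "prob (a \<inter> ?E) = (LINT \<omega>:a|M. real_cond_exp M F (\<lambda>\<omega>. indicator A (Y \<omega>)) \<omega>)"
        using real_cond_exp_intA[OF int a] lhs[OF a] by simp
      also have "\<dots> = (LINT \<omega>:a|M. prob ?E)"
        using c aM[OF a] by (intro set_lebesgue_integral_cong_AE) (auto elim!: eventually_mono)
      finally show "prob (a \<inter> ?E) = prob a * prob ?E" using rhs[OF a] by simp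
    qed
  next
    assume ?indep
    thus ?const using lhs rhs int by (intro real_cond_exp_charact) auto
  qed
qed

lemma subalgebra_vimage_algebra:
  assumes "random_variable N Z"
  shows "subalgebra M (vimage_algebra (space M) Z N)"
proof -
  have "{Z -` A \<inter> space M | A. A \<in> sets N} \<subseteq> events" using measurable_sets[OF assms] by blast
  from sets.sigma_sets_subset[OF this] show ?thesis unfolding subalgebra_def sets_vimage_algebra by simp
qed

end

text \<open>A Markov chain whose neighbours are independent. That more distant variables are independent as well is a
  consequence, proved below.\<close>

locale independent_chain = prob_space +
  fixes U :: "nat \<Rightarrow> 'a \<Rightarrow> real"
  assumes U[measurable]: "random_variable borel (U i)"
    and markov: "markov_property M U"
    and consecutive: "indep_var borel (U i) borel (U (Suc i))"
begin

definition past :: "nat \<Rightarrow> 'a measure" where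
  "past n = vimage_algebra (space M) (\<lambda>\<omega>. \<lambda>i\<in>{..n}. U i \<omega>) (PiM {..n} (\<lambda>_. borel))"

lemma subalgebra_past: "subalgebra M (past n)"
  unfolding past_def by (intro subalgebra_vimage_algebra) measurable

lemma measurable_past_imp_random_variable: "Z \<in> past n \<rightarrow>\<^sub>M N \<Longrightarrow> random_variable N Z"
  by (rule measurable_from_subalg[OF subalgebra_past])

lemma measurable_past[measurable (raw)]: "i \<le> n \<Longrightarrow> U i \<in> past n \<rightarrow>\<^sub>M borel"
proof -
  assume i: "i \<le> n"
  have "(\<lambda>\<omega>. \<lambda>i\<in>{..n}. U i \<omega>) \<in> past n \<rightarrow>\<^sub>M PiM {..n} (\<lambda>_. borel)"
    unfolding past_def by (rule measurable_vimage_algebra1) (auto simp: space_PiM)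
  from measurable_compose[OF this measurable_component_singleton[of i]] i show ?thesis by simp
qed

text \<open>Independence of \<open>U n\<close> and \<open>U (n + 1)\<close> makes the conditional expectation given \<open>U n\<close> constant; by the Markov
  property it equals the one given the past.\<close>

lemma indep_past_next_event:
  assumes a: "a \<in> sets (past n)" and A: "A \<in> sets borel"
  shows "prob (a \<inter> (U (Suc n) -` A \<inter> space M)) = prob a * prob (U (Suc n) -` A \<inter> space M)"
proof -
  let ?F1 = "vimage_algebra (space M) (U n) borel"
  have "\<forall>a\<in>sets ?F1. prob (a \<inter> (U (Suc n) -` A \<inter> space M)) = prob a * prob (U (Suc n) -` A \<inter> space M)"
  proof
    fix a assume a: "a \<in> sets ?F1"
    have "U (Suc n) -` A \<inter> space M \<in> sigma_sets (space M) {U (Suc n) -` A \<inter> space M | A. A \<in> sets borel}"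
      using A by (intro sigma_sets.Basic) blast
    thus "prob (a \<inter> (U (Suc n) -` A \<inter> space M)) = prob a * prob (U (Suc n) -` A \<inter> space M)"
      using consecutive[of n] a unfolding indep_var_eq sets_vimage_algebra
      by (intro indep_setD[of "sigma_sets (space M) {U n -` A \<inter> space M | A. A \<in> sets borel}"]) simp_all
  qed
  hence "AE \<omega> in M. real_cond_exp M ?F1 (\<lambda>\<omega>. indicator A (U (Suc n) \<omega>)) \<omega> = prob (U (Suc n) -` A \<inter> space M)"
    using cond_exp_indicator_const_iff_indep[OF subalgebra_vimage_algebra[OF U] U A] by blast
  moreover have "AE \<omega> in M. real_cond_exp M (past n) (\<lambda>\<omega>. indicator A (U (Suc n) \<omega>)) \<omega>
      = real_cond_exp M ?F1 (\<lambda>\<omega>. indicator A (U (Suc n) \<omega>)) \<omega>"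
    using markov A by (simp add: markov_property_def past_def)
  ultimately have "AE \<omega> in M. real_cond_exp M (past n) (\<lambda>\<omega>. indicator A (U (Suc n) \<omega>)) \<omega> = prob (U (Suc n) -` A \<inter> space M)"
    by eventually_elim simp
  thus ?thesis using cond_exp_indicator_const_iff_indep[OF subalgebra_past U A] a by blast
qed

lemma indep_var_past_next:
  assumes Z: "Z \<in> past n \<rightarrow>\<^sub>M N" and g[measurable]: "g \<in> borel \<rightarrow>\<^sub>M N"
  shows "indep_var N Z N (\<lambda>\<omega>. g (U (Suc n) \<omega>))"
proof -
  have Z'[measurable]: "random_variable N Z" by (rule measurable_past_imp_random_variable[OF Z])
  have "indep_set (sets (vimage_algebra (space M) Z N)) (sets (vimage_algebra (space M) (\<lambda>\<omega>. g (U (Suc n) \<omega>)) N))"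
  proof (rule indep_setI)
    fix a b assume "a \<in> sets (vimage_algebra (space M) Z N)"
      and "b \<in> sets (vimage_algebra (space M) (\<lambda>\<omega>. g (U (Suc n) \<omega>)) N)"
    moreover have "Z \<in> space M \<rightarrow> space N" "(\<lambda>\<omega>. g (U (Suc n) \<omega>)) \<in> space M \<rightarrow> space N"
      by (intro measurable_space[THEN funcsetI]; measurable)+
    ultimately obtain A B where A: "A \<in> sets N" "a = Z -` A \<inter> space M"
      and B: "B \<in> sets N" "b = (\<lambda>\<omega>. g (U (Suc n) \<omega>)) -` B \<inter> space M"
      by (auto simp: sets_vimage_algebra2)
    have "a \<in> sets (past n)" using measurable_sets[OF Z A(1)] A(2) by (simp add: past_def)
    moreover have "b = U (Suc n) -` (g -` B) \<inter> space M" using B(2) by auto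
    moreover have "g -` B \<in> sets borel" using measurable_sets[OF g B(1)] by simp
    ultimately show "prob (a \<inter> b) = prob a * prob b" by (simp only: indep_past_next_event)
  next
    show "sets (vimage_algebra (space M) Z N) \<subseteq> events"
      using subalgebra_vimage_algebra[of Z N] by (simp add: subalgebra_def)
    show "sets (vimage_algebra (space M) (\<lambda>\<omega>. g (U (Suc n) \<omega>)) N) \<subseteq> events"
      using subalgebra_vimage_algebra[of "\<lambda>\<omega>. g (U (Suc n) \<omega>)" N] by (simp add: subalgebra_def)
  qed
  thus ?thesis unfolding indep_var_eq sets_vimage_algebra by simp
qed

lemma integrable_bounded:
  fixes Z :: "'a \<Rightarrow> 'c::{banach, second_countable_topology}"
  assumes "random_variable borel Z" "\<And>\<omega>. norm (Z \<omega>) \<le> B"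
  shows "integrable M Z"
  using assms by (intro integrable_const_bound[of _ B]) auto

text \<open>Independence of past and next variable, in the form that all moment computations use.\<close>

lemma expectation_past_times_next:
  fixes Z :: "'a \<Rightarrow> 'c::{real_normed_field, banach, second_countable_topology}"
  assumes Z: "Z \<in> borel_measurable (past n)" "\<And>\<omega>. norm (Z \<omega>) \<le> B"
    and g[measurable]: "g \<in> borel_measurable borel" "\<And>x. norm (g x) \<le> C"
  shows "expectation (\<lambda>\<omega>. Z \<omega> * g (U (Suc n) \<omega>)) = expectation Z * expectation (\<lambda>\<omega>. g (U (Suc n) \<omega>))"
  by (intro indep_var_lebesgue_integral indep_var_past_next Z(1) g(1)
      integrable_bounded[OF measurable_past_imp_random_variable[OF Z(1)] Z(2)]
      integrable_bounded[OF measurable_compose[OF U g(1)] g(2)])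

end

section \<open>Central limit theorem for products of consecutive orthonormal functions\<close>

text \<open>The index \<open>j\<close> names an estimator. The same functions serve for every \<open>i\<close>: the chain is stationary, and so the
  moment conditions are imposed at every time.\<close>

locale orthonormal_chain = independent_chain +
  fixes \<phi> :: "'j \<Rightarrow> real \<Rightarrow> real" and J :: "'j set" and b :: real
  assumes finite_J: "finite J"
    and \<phi>_measurable[measurable]: "\<phi> j \<in> borel_measurable borel"
    and \<phi>_bounded: "\<bar>\<phi> j x\<bar> \<le> b"
    and \<phi>_mean: "j \<in> J \<Longrightarrow> expectation (\<lambda>\<omega>. \<phi> j (U i \<omega>)) = 0"
    and \<phi>_orthonormal: "j \<in> J \<Longrightarrow> k \<in> J \<Longrightarrow>
      expectation (\<lambda>\<omega>. \<phi> j (U i \<omega>) * \<phi> k (U i \<omega>)) = (if j = k then 1 else 0)"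
begin

definition step :: "('j \<Rightarrow> real) \<Rightarrow> nat \<Rightarrow> 'a \<Rightarrow> real" where
  "step t i \<omega> = (\<Sum>j\<in>J. t j * \<phi> j (U i \<omega>) * \<phi> j (U (Suc i) \<omega>))"

definition step_bound :: "('j \<Rightarrow> real) \<Rightarrow> real" where
  "step_bound t = (\<Sum>j\<in>J. \<bar>t j\<bar> * b * b)"

lemma step_measurable[measurable]: "random_variable borel (step t i)"
  unfolding step_def by measurable

lemma step_measurable_past: "i < n \<Longrightarrow> step t i \<in> borel_measurable (past n)"
  unfolding step_def by measurable

lemma b_nonneg: "0 \<le> b"
  using \<phi>_bounded[of undefined 0] by linarith

lemma step_bounded: "\<bar>step t i \<omega>\<bar> \<le> step_bound t"
  unfolding step_def step_bound_def
  by (rule order_trans[OF sum_abs]) (auto intro!: sum_mono mult_mono \<phi>_bounded b_nonneg mult_nonneg_nonneg simp: abs_mult)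

lemma step_bound_nonneg: "0 \<le> step_bound t"
  using step_bounded[of t 0 undefined] by linarith

text \<open>The martingale difference property: the last factor \<open>\<phi> j (U (n + 1))\<close> of each summand is independent of the past
  and has mean zero.\<close>

lemma expectation_past_times_step:
  assumes Z: "Z \<in> borel_measurable (past n)" "\<And>\<omega>. cmod (Z \<omega>) \<le> B"
  shows "expectation (\<lambda>\<omega>. Z \<omega> * complex_of_real (step t n \<omega>)) = 0"
proof -
  have Zm[measurable]: "random_variable borel Z" by (rule measurable_past_imp_random_variable[OF Z(1)])
  have Z0: "expectation (\<lambda>\<omega>. (Z \<omega> * complex_of_real (t j * \<phi> j (U n \<omega>))) * complex_of_real (\<phi> j (U (Suc n) \<omega>))) = 0"
    and int: "integrable M (\<lambda>\<omega>. (Z \<omega> * complex_of_real (t j * \<phi> j (U n \<omega>))) * complex_of_real (\<phi> j (U (Suc n) \<omega>)))" if j: "j \<in> J" for j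
  proof -
    have bd: "cmod (Z \<omega> * complex_of_real (t j * \<phi> j (U n \<omega>))) \<le> B * (\<bar>t j\<bar> * b)" for \<omega>
      unfolding norm_mult norm_of_real abs_mult
      using order_trans[OF norm_ge_zero Z(2)] by (intro mult_mono Z(2) \<phi>_bounded order_refl) auto
    have "expectation (\<lambda>\<omega>. (Z \<omega> * complex_of_real (t j * \<phi> j (U n \<omega>))) * complex_of_real (\<phi> j (U (Suc n) \<omega>)))
        = expectation (\<lambda>\<omega>. Z \<omega> * complex_of_real (t j * \<phi> j (U n \<omega>))) * expectation (\<lambda>\<omega>. complex_of_real (\<phi> j (U (Suc n) \<omega>)))"
    proof (rule expectation_past_times_next[OF _ bd])
      show "(\<lambda>\<omega>. Z \<omega> * complex_of_real (t j * \<phi> j (U n \<omega>))) \<in> borel_measurable (past n)"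
        using Z(1) by measurable
      show "norm (complex_of_real (\<phi> j x)) \<le> b" for x using \<phi>_bounded by simp
    qed measurable
    thus "expectation (\<lambda>\<omega>. (Z \<omega> * complex_of_real (t j * \<phi> j (U n \<omega>))) * complex_of_real (\<phi> j (U (Suc n) \<omega>))) = 0"
      using \<phi>_mean[OF j] by simp
    show "integrable M (\<lambda>\<omega>. (Z \<omega> * complex_of_real (t j * \<phi> j (U n \<omega>))) * complex_of_real (\<phi> j (U (Suc n) \<omega>)))"
    proof (rule integrable_bounded)
      show "norm ((Z \<omega> * complex_of_real (t j * \<phi> j (U n \<omega>))) * complex_of_real (\<phi> j (U (Suc n) \<omega>))) \<le> (B * (\<bar>t j\<bar> * b)) * b" for \<omega>
        unfolding norm_mult[of "Z \<omega> * _"] using \<phi>_bounded order_trans[OF norm_ge_zero bd] by (intro mult_mono bd) auto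
    qed measurable
  qed
  have "(\<lambda>\<omega>. Z \<omega> * complex_of_real (step t n \<omega>))
      = (\<lambda>\<omega>. \<Sum>j\<in>J. (Z \<omega> * complex_of_real (t j * \<phi> j (U n \<omega>))) * complex_of_real (\<phi> j (U (Suc n) \<omega>)))"
    by (simp add: step_def sum_distrib_left mult.assoc)
  thus ?thesis using Z0 int by simp
qed

text \<open>Expanding the last factor of the product leaves the shorter product plus a multiple of a past variable times a
  step, whose expectation is zero.\<close>

lemma expectation_step_product:
  "expectation (\<lambda>\<omega>. \<Prod>i<m. (1 + \<i> * complex_of_real (u * step t i \<omega>))) = 1"
proof (induction m)
  case 0
  show ?case by (simp add: prob_space)
next
  case (Suc m)
  define T where "T \<omega> = (\<Prod>i<m. (1 + \<i> * complex_of_real (u * step t i \<omega>)))" for \<omega>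
  have Tp: "T \<in> borel_measurable (past m)"
    unfolding T_def using step_measurable_past[of _ m t] by measurable
  have Tm[measurable]: "random_variable borel T" by (rule measurable_past_imp_random_variable[OF Tp])
  have Tb: "cmod (T \<omega>) \<le> (1 + \<bar>u\<bar> * step_bound t) ^ m" for \<omega>
  proof -
    have "cmod (T \<omega>) \<le> (\<Prod>i<m. 1 + \<bar>u\<bar> * step_bound t)"
      unfolding T_def prod_norm[symmetric]
    proof (intro prod_mono conjI norm_ge_zero)
      fix i
      have "cmod (1 + \<i> * complex_of_real (u * step t i \<omega>)) \<le> cmod 1 + cmod (\<i> * complex_of_real (u * step t i \<omega>))"
        by (rule norm_triangle_ineq)
      also have "\<dots> = 1 + \<bar>u\<bar> * \<bar>step t i \<omega>\<bar>" by (simp add: norm_mult abs_mult)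
      also have "\<dots> \<le> 1 + \<bar>u\<bar> * step_bound t" by (intro add_left_mono mult_left_mono step_bounded) auto
      finally show "cmod (1 + \<i> * complex_of_real (u * step t i \<omega>)) \<le> 1 + \<bar>u\<bar> * step_bound t" .
    qed
    thus ?thesis by simp
  qed
  have iT: "integrable M T" by (rule integrable_bounded[OF Tm Tb])
  have iTs: "integrable M (\<lambda>\<omega>. T \<omega> * complex_of_real (step t m \<omega>))"
  proof (rule integrable_bounded)
    show "cmod (T \<omega> * complex_of_real (step t m \<omega>)) \<le> (1 + \<bar>u\<bar> * step_bound t) ^ m * step_bound t" for \<omega>
      unfolding norm_mult norm_of_real using order_trans[OF norm_ge_zero Tb] by (intro mult_mono Tb step_bounded) auto
  qed measurable
  have "(\<Prod>i<Suc m. (1 + \<i> * complex_of_real (u * step t i \<omega>)))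
      = T \<omega> + (\<i> * u) * (T \<omega> * complex_of_real (step t m \<omega>))" for \<omega>
    by (simp add: T_def algebra_simps)
  hence "expectation (\<lambda>\<omega>. \<Prod>i<Suc m. (1 + \<i> * complex_of_real (u * step t i \<omega>)))
      = expectation T + (\<i> * u) * expectation (\<lambda>\<omega>. T \<omega> * complex_of_real (step t m \<omega>))"
    using iT iTs by simp
  also have "\<dots> = 1" using Suc.IH expectation_past_times_step[OF Tp Tb] by (simp add: T_def[abs_def])
  finally show ?case .
qed

end

context orthonormal_chain begin

text \<open>The square of a step is a double sum over \<open>j\<close> and \<open>k\<close> of \<open>\<phi> j * \<phi> k\<close> at the times \<open>n\<close> and \<open>n + 1\<close>. Averaging over
  time \<open>n + 1\<close> kills the terms with \<open>j \<noteq> k\<close> by orthonormality; the remaining functions of \<open>U n\<close> have mean 1 and, by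
  the last hypothesis, are uncorrelated with \<open>Z\<close>.\<close>

lemma expectation_times_step_square:
  fixes Z :: "'a \<Rightarrow> real"
  assumes Z: "Z \<in> borel_measurable (past n)" "\<And>\<omega>. \<bar>Z \<omega>\<bar> \<le> B"
    and uncorrelated: "\<And>g :: real \<Rightarrow> real. g \<in> borel_measurable borel \<Longrightarrow> (\<And>x. \<bar>g x\<bar> \<le> b * b) \<Longrightarrow>
      expectation (\<lambda>\<omega>. Z \<omega> * g (U n \<omega>)) = expectation Z * expectation (\<lambda>\<omega>. g (U n \<omega>))"
  shows "expectation (\<lambda>\<omega>. Z \<omega> * (step t n \<omega>)\<^sup>2) = (\<Sum>j\<in>J. (t j)\<^sup>2) * expectation Z"
proof -
  have Zm[measurable]: "random_variable borel Z" by (rule measurable_past_imp_random_variable[OF Z(1)])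
  have B: "0 \<le> B" using Z(2)[of undefined] by linarith
  define Y where "Y j k \<omega> = (Z \<omega> * (t j * t k)) * (\<phi> j (U n \<omega>) * \<phi> k (U n \<omega>))" for j k \<omega>
  define g where "g j k x = \<phi> j x * \<phi> k x" for j k x
  have [measurable]: "g j k \<in> borel_measurable borel" for j k unfolding g_def by measurable
  have gb: "\<bar>g j k x\<bar> \<le> b * b" for j k x
    unfolding g_def abs_mult by (intro mult_mono \<phi>_bounded b_nonneg) auto
  have Ztb: "\<bar>Z \<omega> * (t j * t k)\<bar> \<le> B * \<bar>t j * t k\<bar>" for j k \<omega>
    unfolding abs_mult[of "Z \<omega>"] by (intro mult_right_mono Z(2)) auto
  have Yg: "Y j k = (\<lambda>\<omega>. (Z \<omega> * (t j * t k)) * g j k (U n \<omega>))" for j k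
    by (simp add: Y_def g_def fun_eq_iff)
  have Ym[measurable]: "random_variable borel (Y j k)" for j k unfolding Yg by measurable
  have Yb: "\<bar>Y j k \<omega>\<bar> \<le> B * \<bar>t j * t k\<bar> * (b * b)" for j k \<omega>
    unfolding Yg abs_mult[of "Z \<omega> * _"] using B by (intro mult_mono Ztb gb) auto
  have Yp: "Y j k \<in> borel_measurable (past n)" for j k
    unfolding Yg using Z(1) by measurable
  have int: "integrable M (\<lambda>\<omega>. Y j k \<omega> * g j k (U (Suc n) \<omega>))" for j k
  proof (rule integrable_bounded)
    show "norm (Y j k \<omega> * g j k (U (Suc n) \<omega>)) \<le> B * \<bar>t j * t k\<bar> * (b * b) * (b * b)" for \<omega>
      unfolding real_norm_def abs_mult[of "Y j k \<omega>"]
      using B b_nonneg by (intro mult_mono Yb gb) auto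
  qed measurable
  have E: "expectation (\<lambda>\<omega>. Y j k \<omega> * g j k (U (Suc n) \<omega>)) = (if j = k then (t j)\<^sup>2 * expectation Z else 0)"
    if jk: "j \<in> J" "k \<in> J" for j k
  proof -
    have gE: "expectation (\<lambda>\<omega>. g j k (U i \<omega>)) = (if j = k then 1 else 0)" for i
      unfolding g_def by (rule \<phi>_orthonormal[OF jk])
    have "expectation (\<lambda>\<omega>. Y j k \<omega> * g j k (U (Suc n) \<omega>)) = expectation (Y j k) * expectation (\<lambda>\<omega>. g j k (U (Suc n) \<omega>))"
      by (rule expectation_past_times_next[OF Yp _ _ , of j k "B * \<bar>t j * t k\<bar> * (b * b)" "g j k" "b * b"])
         (use Yb gb in auto)
    also have "expectation (Y j k) = (t j * t k) * expectation (\<lambda>\<omega>. Z \<omega> * g j k (U n \<omega>))"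
      unfolding Yg by (simp flip: integral_mult_right_zero add: mult_ac)
    also have "expectation (\<lambda>\<omega>. Z \<omega> * g j k (U n \<omega>)) = expectation Z * expectation (\<lambda>\<omega>. g j k (U n \<omega>))"
      by (rule uncorrelated) (use gb in auto)
    finally show ?thesis unfolding gE by (simp add: power2_eq_square)
  qed
  have "Z \<omega> * (step t n \<omega>)\<^sup>2 = (\<Sum>j\<in>J. \<Sum>k\<in>J. Y j k \<omega> * g j k (U (Suc n) \<omega>))" for \<omega>
  proof -
    have "(step t n \<omega>)\<^sup>2 = (\<Sum>j\<in>J. \<Sum>k\<in>J. (t j * \<phi> j (U n \<omega>) * \<phi> j (U (Suc n) \<omega>)) * (t k * \<phi> k (U n \<omega>) * \<phi> k (U (Suc n) \<omega>)))"
      by (simp only: step_def power2_eq_square sum_product)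
    thus ?thesis by (simp add: sum_distrib_left Y_def g_def mult_ac)
  qed
  hence "expectation (\<lambda>\<omega>. Z \<omega> * (step t n \<omega>)\<^sup>2)
      = (\<Sum>j\<in>J. \<Sum>k\<in>J. expectation (\<lambda>\<omega>. Y j k \<omega> * g j k (U (Suc n) \<omega>)))"
    using int by simp
  also have "\<dots> = (\<Sum>j\<in>J. \<Sum>k\<in>J. if j = k then (t j)\<^sup>2 * expectation Z else 0)"
    using E by (intro sum.cong refl) auto
  also have "\<dots> = (\<Sum>j\<in>J. (t j)\<^sup>2) * expectation Z"
    using finite_J by (simp add: sum.delta sum_distrib_right)
  finally show ?thesis .
qed

lemma expectation_step_square: "expectation (\<lambda>\<omega>. (step t i \<omega>)\<^sup>2) = (\<Sum>j\<in>J. (t j)\<^sup>2)"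
  using expectation_times_step_square[of "\<lambda>_. 1" i 1 t] by (simp add: prob_space)

text \<open>The step at time \<open>m + 1\<close> involves \<open>U (m + 1)\<close> and \<open>U (m + 2)\<close>, both independent of what is known at time \<open>m\<close>.\<close>

lemma expectation_old_times_step_square:
  fixes Z :: "'a \<Rightarrow> real"
  assumes Z: "Z \<in> borel_measurable (past m)" "Z \<in> borel_measurable (past (Suc m))" "\<And>\<omega>. \<bar>Z \<omega>\<bar> \<le> B"
  shows "expectation (\<lambda>\<omega>. Z \<omega> * (step t (Suc m) \<omega>)\<^sup>2) = (\<Sum>j\<in>J. (t j)\<^sup>2) * expectation Z"
proof (rule expectation_times_step_square[OF Z(2,3)])
  fix g :: "real \<Rightarrow> real" assume "g \<in> borel_measurable borel" "\<And>x. \<bar>g x\<bar> \<le> b * b"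
  thus "expectation (\<lambda>\<omega>. Z \<omega> * g (U (Suc m) \<omega>)) = expectation Z * expectation (\<lambda>\<omega>. g (U (Suc m) \<omega>))"
    using expectation_past_times_next[OF Z(1), of B g "b * b"] Z(3) by simp
qed

lemma step_square_bounded: "\<bar>(step t i \<omega>)\<^sup>2 - v\<bar> \<le> (step_bound t)\<^sup>2 + \<bar>v\<bar>"
proof -
  have "(step t i \<omega>)\<^sup>2 \<le> (step_bound t)\<^sup>2"
    using power_mono[OF step_bounded abs_ge_zero, of t i \<omega> 2] by simp
  thus ?thesis using zero_le_power2[of "step t i \<omega>"] by linarith
qed

lemma square_sum_eq_double_sum: "(\<Sum>i<n. f i)\<^sup>2 = (\<Sum>i<n. \<Sum>k<n. f i * f k)" for f :: "nat \<Rightarrow> real"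
  by (simp add: power2_eq_square sum_product)

lemma expectation_sum_step_square:
  "expectation (\<lambda>\<omega>. (\<Sum>i<n. step t i \<omega>)\<^sup>2) = n * (\<Sum>j\<in>J. (t j)\<^sup>2)"
proof -
  have b: "\<bar>step t i \<omega> * step t k \<omega>\<bar> \<le> step_bound t * step_bound t" for i k \<omega>
    unfolding abs_mult by (intro mult_mono step_bounded step_bound_nonneg) auto
  have int: "integrable M (\<lambda>\<omega>. step t i \<omega> * step t k \<omega>)" for i k
    by (rule integrable_bounded[of _ "step_bound t * step_bound t"]) (use b in auto)
  have later: "expectation (\<lambda>\<omega>. step t i \<omega> * step t k \<omega>) = 0" if "i < k" for i k
  proof -
    have "expectation (\<lambda>\<omega>. complex_of_real (step t i \<omega>) * complex_of_real (step t k \<omega>)) = 0"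
      by (rule expectation_past_times_step[of _ _ "step_bound t"])
         (use step_measurable_past[OF that, of t] step_bounded in auto)
    thus ?thesis by (simp flip: of_real_mult)
  qed
  have E: "expectation (\<lambda>\<omega>. step t i \<omega> * step t k \<omega>) = (if i = k then \<Sum>j\<in>J. (t j)\<^sup>2 else 0)" for i k
    using later[of i k] later[of k i] expectation_step_square[of t i]
    by (cases i k rule: linorder_cases) (simp_all add: mult.commute power2_eq_square)
  show ?thesis unfolding square_sum_eq_double_sum using int by (simp add: E)
qed

text \<open>Centred squares whose times differ by at least two are uncorrelated, so in the double sum only the three
  neighbours \<open>k = i - 1, i, i + 1\<close> of each \<open>i\<close> contribute.\<close>

lemma expectation_sum_centred_step_square:
  fixes t :: "'j \<Rightarrow> real"
  defines "v \<equiv> \<Sum>j\<in>J. (t j)\<^sup>2"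
  shows "expectation (\<lambda>\<omega>. (\<Sum>i<n. (step t i \<omega>)\<^sup>2 - v)\<^sup>2) \<le> 3 * ((step_bound t)\<^sup>2 + v)\<^sup>2 * n"
proof -
  define Y where "Y i \<omega> = (step t i \<omega>)\<^sup>2 - v" for i \<omega>
  define C where "C = (step_bound t)\<^sup>2 + v"
  have v: "0 \<le> v" unfolding v_def by (simp add: sum_nonneg)
  have C: "0 \<le> C" using v by (simp add: C_def)
  have [measurable]: "random_variable borel (Y i)" for i unfolding Y_def by measurable
  have Yb: "\<bar>Y i \<omega>\<bar> \<le> C" for i \<omega>
    using step_square_bounded[of t i \<omega> v] v by (simp add: Y_def C_def)
  have b: "\<bar>Y i \<omega> * Y k \<omega>\<bar> \<le> C\<^sup>2" for i k \<omega>
    unfolding abs_mult power2_eq_square using C by (intro mult_mono Yb) auto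
  have int1: "integrable M (Y i)" for i by (rule integrable_bounded[of _ C]) (use Yb in auto)
  have int: "integrable M (\<lambda>\<omega>. Y i \<omega> * Y k \<omega>)" for i k
    by (rule integrable_bounded[of _ "C\<^sup>2"]) (use b in auto)
  have far: "expectation (\<lambda>\<omega>. Y i \<omega> * Y k \<omega>) = 0" if ik: "i + 2 \<le> k" for i k
  proof -
    obtain m where m: "k = Suc m" "i < m" using ik by (cases k) auto
    have p: "Y i \<in> borel_measurable (past k)" if "i < k" for k
      unfolding Y_def using step_measurable_past[OF that, of t] by measurable
    have "i < Suc m" using m by simp
    have "expectation (\<lambda>\<omega>. Y i \<omega> * (step t k \<omega>)\<^sup>2) = v * expectation (Y i)"
      unfolding m(1) v_def by (rule expectation_old_times_step_square[OF p[OF m(2)] p[OF \<open>i < Suc m\<close>] Yb])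
    moreover have "integrable M (\<lambda>\<omega>. Y i \<omega> * (step t k \<omega>)\<^sup>2)"
    proof (rule integrable_bounded)
      show "norm (Y i \<omega> * (step t k \<omega>)\<^sup>2) \<le> C * (step_bound t)\<^sup>2" for \<omega>
        unfolding real_norm_def abs_mult[of "Y i \<omega>"] using C power_mono[OF step_bounded abs_ge_zero, of t k \<omega> 2]
        by (intro mult_mono Yb) auto
    qed measurable
    moreover have "(\<lambda>\<omega>. Y i \<omega> * Y k \<omega>) = (\<lambda>\<omega>. Y i \<omega> * (step t k \<omega>)\<^sup>2 - Y i \<omega> * v)"
      by (simp add: Y_def[of k] right_diff_distrib)
    ultimately show ?thesis using int1 by simp
  qed
  have E: "expectation (\<lambda>\<omega>. Y i \<omega> * Y k \<omega>) \<le> (if k \<in> {i - 1..i + 1} then C\<^sup>2 else 0)" for i k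
  proof (cases "k \<in> {i - 1..i + 1}")
    case True
    have "expectation (\<lambda>\<omega>. Y i \<omega> * Y k \<omega>) \<le> expectation (\<lambda>\<omega>. C\<^sup>2)"
      using b by (intro integral_mono int) (auto simp: abs_le_iff)
    thus ?thesis using True by (simp add: prob_space)
  next
    case False
    hence "i + 2 \<le> k \<or> k + 2 \<le> i" by auto
    thus ?thesis using far[of i k] far[of k i] False by (auto simp: mult.commute)
  qed
  have "expectation (\<lambda>\<omega>. (\<Sum>i<n. Y i \<omega>)\<^sup>2) = (\<Sum>i<n. \<Sum>k<n. expectation (\<lambda>\<omega>. Y i \<omega> * Y k \<omega>))"
    unfolding square_sum_eq_double_sum using int by simp
  also have "\<dots> \<le> (\<Sum>i<n. 3 * C\<^sup>2)"
  proof (rule sum_mono)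
    fix i
    have "(\<Sum>k<n. expectation (\<lambda>\<omega>. Y i \<omega> * Y k \<omega>)) \<le> (\<Sum>k<n. if k \<in> {i - 1..i + 1} then C\<^sup>2 else 0)"
      by (intro sum_mono E)
    also have "\<dots> = card ({..<n} \<inter> {i - 1..i + 1}) * C\<^sup>2"
      by (subst sum.inter_restrict[symmetric]) auto
    also have "\<dots> \<le> 3 * C\<^sup>2"
    proof (rule mult_right_mono)
      have "card ({..<n} \<inter> {i - 1..i + 1}) \<le> card {i - 1..i + 1}" by (intro card_mono) auto
      also have "\<dots> \<le> 3" by simp
      finally show "real (card ({..<n} \<inter> {i - 1..i + 1})) \<le> 3" by simp
    qed simp
    finally show "(\<Sum>k<n. expectation (\<lambda>\<omega>. Y i \<omega> * Y k \<omega>)) \<le> 3 * C\<^sup>2" .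
  qed
  also have "\<dots> = 3 * C\<^sup>2 * n" by simp
  finally show ?thesis by (simp add: Y_def C_def)
qed

theorem step_clt:
  "(\<lambda>n. expectation (\<lambda>\<omega>. iexp ((\<Sum>i<n. step t i \<omega>) / sqrt n))) \<longlonglongrightarrow> exp (- (\<Sum>j\<in>J. (t j)\<^sup>2) / 2)"
  by (rule characteristic_clt_of_martingale_products[OF step_measurable step_bounded
        expectation_step_product expectation_sum_centred_step_square])
     (simp add: sum_nonneg)

end

context orthonormal_chain begin

text \<open>For the trigonometric functions this is \<open>\<surd>n\<close> times an estimator.\<close>

definition score :: "nat \<Rightarrow> 'j \<Rightarrow> 'a \<Rightarrow> real" where
  "score n j \<omega> = (\<Sum>i<n. \<phi> j (U i \<omega>) * \<phi> j (U (Suc i) \<omega>)) / sqrt n"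

lemma score_measurable[measurable]: "random_variable borel (score n j)"
  unfolding score_def by measurable

text \<open>Reduces the joint behaviour of the scores to sums of steps: this is where the Cramer-Wold device enters.\<close>

lemma linear_combination_of_scores:
  "(\<Sum>j\<in>J. t j * score n j \<omega>) = (\<Sum>i<n. step t i \<omega>) / sqrt n"
proof -
  have "(\<Sum>i<n. step t i \<omega>) = (\<Sum>j\<in>J. \<Sum>i<n. t j * (\<phi> j (U i \<omega>) * \<phi> j (U (Suc i) \<omega>)))"
    unfolding step_def by (subst sum.swap) (simp add: mult.assoc)
  thus ?thesis by (simp add: score_def sum_divide_distrib sum_distrib_left)
qed

lemma phase_of_scores_tendsto:
  "(\<lambda>n. expectation (\<lambda>\<omega>. cos ((\<Sum>j\<in>J. t j * score n j \<omega>) + a)))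
    \<longlonglongrightarrow> Re (iexp a * exp (- (\<Sum>j\<in>J. (t j)\<^sup>2) / 2))"
proof -
  have "expectation (\<lambda>\<omega>. cos ((\<Sum>j\<in>J. t j * score n j \<omega>) + a))
      = Re (iexp a * expectation (\<lambda>\<omega>. iexp ((\<Sum>i<n. step t i \<omega>) / sqrt n)))" for n
    unfolding linear_combination_of_scores by (rule expectation_cos_eq_Re_iexp) measurable
  thus ?thesis by (simp only:) (intro tendsto_Re tendsto_mult tendsto_const step_clt)
qed

text \<open>A score is the linear combination with a single coefficient 1, and steps are uncorrelated with variance
  \<open>\<Sum> (t j)\<^sup>2\<close>. For \<open>n = 0\<close> the score is 0, so the moment is only bounded by 1.\<close>

lemma score_second_moment:
  "integrable M (\<lambda>\<omega>. (score n j \<omega>)\<^sup>2)" "j \<in> J \<Longrightarrow> expectation (\<lambda>\<omega>. (score n j \<omega>)\<^sup>2) \<le> 1"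
proof -
  have "\<bar>score n j \<omega>\<bar> \<le> (\<Sum>i<n. b * b) / sqrt n" for \<omega>
    unfolding score_def abs_divide abs_of_nonneg[OF real_sqrt_ge_zero[OF of_nat_0_le_iff]]
    by (intro divide_right_mono order_trans[OF sum_abs] sum_mono)
       (auto simp: abs_mult intro!: mult_mono \<phi>_bounded b_nonneg)
  hence "norm ((score n j \<omega>)\<^sup>2) \<le> ((\<Sum>i<n. b * b) / sqrt n)\<^sup>2" for \<omega>
    using power_mono[OF _ abs_ge_zero, of "score n j \<omega>" "(\<Sum>i<n. b * b) / sqrt n" 2]
    by (simp only: real_norm_def power_abs)
  thus "integrable M (\<lambda>\<omega>. (score n j \<omega>)\<^sup>2)" by (intro integrable_bounded[of _ "((\<Sum>i<n. b * b) / sqrt n)\<^sup>2"]) auto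
  assume j: "j \<in> J"
  define t where "t i = (if i = j then 1 else 0 :: real)" for i
  have "score n j \<omega> = (\<Sum>i<n. step t i \<omega>) / sqrt n" for \<omega>
    using linear_combination_of_scores[of t n \<omega>] j finite_J
    by (simp add: t_def if_distrib[of "\<lambda>u. u * _"] sum.delta cong: if_cong)
  hence "expectation (\<lambda>\<omega>. (score n j \<omega>)\<^sup>2) = expectation (\<lambda>\<omega>. (\<Sum>i<n. step t i \<omega>)\<^sup>2) / n"
    by (simp add: power_divide)
  also have "\<dots> = n * (\<Sum>i\<in>J. (t i)\<^sup>2) / n" by (simp add: expectation_sum_step_square)
  also have "(\<Sum>i\<in>J. (t i)\<^sup>2) = 1"
    using j finite_J by (simp add: t_def if_distrib[of "\<lambda>u. u\<^sup>2"] sum.delta cong: if_cong)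
  finally show "expectation (\<lambda>\<omega>. (score n j \<omega>)\<^sup>2) \<le> 1" by simp
qed

text \<open>The space \<open>'b\<close> is left open so that the vector of scores can be realised both in Euclidean space and in a space of
  sequences.\<close>

theorem weakly_converges_of_scores:
  fixes p :: "'j \<Rightarrow> 'b::t2_space \<Rightarrow> real"
  assumes X[measurable]: "\<And>n. random_variable borel (X n)"
    and pX: "\<And>n j \<omega>. j \<in> J \<Longrightarrow> p j (X n \<omega>) = score n j \<omega>" and XS: "\<And>n \<omega>. X n \<omega> \<in> S"
    and p: "\<And>j. continuous_on UNIV (p j)"
    and S: "\<And>R. compact {x \<in> S. (\<Sum>j\<in>J. (p j x)\<^sup>2) \<le> R}"
      "\<And>x y. x \<in> S \<Longrightarrow> y \<in> S \<Longrightarrow> (\<And>j. j \<in> J \<Longrightarrow> p j x = p j y) \<Longrightarrow> x = y"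
    and S_borel: "S \<in> sets borel"
    and Q: "prob_space Q" "sets Q = sets borel" "AE x in Q. x \<in> S"
    and Q2: "integrable Q (\<lambda>x. \<Sum>j\<in>J. (p j x)\<^sup>2)" "(\<integral>x. (\<Sum>j\<in>J. (p j x)\<^sup>2) \<partial>Q) \<le> card J"
    and char: "\<And>t. (\<integral>x. iexp (\<Sum>j\<in>J. t j * p j x) \<partial>Q) = exp (- (\<Sum>j\<in>J. (t j)\<^sup>2) / 2)"
  shows "weakly_converges (\<lambda>n. distr M borel (X n)) Q"
proof (rule weakly_converges_if_linear_phases_converge[OF _ _ Q(1,2) p S finite_J _ Q(3) _ _ Q2])
  have [measurable]: "p j \<in> borel_measurable borel" for j using p by (rule borel_measurable_continuous_onI)
  show "prob_space (distr M borel (X n))" for n by (rule prob_space_distr) measurable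
  show "sets (distr M borel (X n)) = sets borel" for n by simp
  show "AE x in distr M borel (X n). x \<in> S" for n
    using S_borel XS by (subst AE_distr_iff) auto
  show "integrable (distr M borel (X n)) (\<lambda>x. \<Sum>j\<in>J. (p j x)\<^sup>2)" for n
    by (simp add: integrable_distr_eq pX score_second_moment)
  have "(\<integral>x. (\<Sum>j\<in>J. (p j x)\<^sup>2) \<partial>distr M borel (X n)) = (\<Sum>j\<in>J. expectation (\<lambda>\<omega>. (score n j \<omega>)\<^sup>2))" for n
    by (simp add: integral_distr pX score_second_moment)
  also have "\<dots> n \<le> (\<Sum>j\<in>J. 1)" for n by (intro sum_mono score_second_moment)
  finally show "(\<integral>x. (\<Sum>j\<in>J. (p j x)\<^sup>2) \<partial>distr M borel (X n)) \<le> card J" for n by simp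
  fix t a
  have [measurable_cong]: "sets Q = sets borel" by fact
  have "(\<integral>x. cos ((\<Sum>j\<in>J. t j * p j x) + a) \<partial>Q) = Re (iexp a * exp (- (\<Sum>j\<in>J. (t j)\<^sup>2) / 2))"
    using prob_space.expectation_cos_eq_Re_iexp[OF Q(1), of "\<lambda>x. \<Sum>j\<in>J. t j * p j x" a] char[of t] by simp
  thus "(\<lambda>n. \<integral>x. cos ((\<Sum>j\<in>J. t j * p j x) + a) \<partial>distr M borel (X n))
      \<longlonglongrightarrow> (\<integral>x. cos ((\<Sum>j\<in>J. t j * p j x) + a) \<partial>Q)"
    using phase_of_scores_tendsto[of t a] by (simp add: integral_distr pX)
qed

end

section \<open>Limits of vectors of scores and of their continuous functions\<close>

lemma borel_measurable_vec_lambda: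
  fixes X :: "'s::finite \<Rightarrow> 'a \<Rightarrow> real"
  assumes "\<And>j. X j \<in> borel_measurable M"
  shows "(\<lambda>\<omega>. \<chi> j. X j \<omega>) \<in> borel_measurable M"
  unfolding borel_measurable_euclidean_space[of "\<lambda>\<omega>. \<chi> j. X j \<omega>"] Basis_vec_def
  using assms by (auto simp: inner_axis)

text \<open>The bijection \<open>\<iota>\<close> turns the index type of the vector into the index set of the estimators.\<close>

theorem (in orthonormal_chain) weakly_converges_of_score_vector:
  fixes \<iota> :: "'s::finite \<Rightarrow> 'j"
  assumes \<iota>: "bij_betw \<iota> UNIV J"
  shows "weakly_converges (\<lambda>n. distr M borel (\<lambda>\<omega>. \<chi> k. score n (\<iota> k) \<omega>)) (normal_distribution 0 (mat 1))"
proof -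
  let ?Q = "normal_distribution (0 :: real ^ 's) (mat 1)"
  let ?s = "\<lambda>f. \<Sum>b\<in>Basis. f b *\<^sub>R b :: real ^ 's"
  have Q: "?Q = distr (std_normal_vector Basis) borel ?s" by (rule standard_normal_distribution_eq)
  have sm[measurable]: "?s \<in> borel_measurable (std_normal_vector Basis)" by measurable
  define p where "p j x = x $ inv \<iota> j" for j and x :: "real ^ 's"
  have inj: "inv \<iota> (\<iota> k) = k" for k using \<iota> by (simp add: bij_betw_def)
  have sumJ: "(\<Sum>j\<in>J. g j) = (\<Sum>k\<in>UNIV. g (\<iota> k))" for g :: "'j \<Rightarrow> real"
    using sum.reindex_bij_betw[OF \<iota>, of g] by simp
  have norm2: "(\<Sum>j\<in>J. (p j x)\<^sup>2) = x \<bullet> x" for x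
    by (simp add: sumJ p_def inj inner_vec_def power2_eq_square)
  have norm2s: "?s f \<bullet> ?s f = (\<Sum>b\<in>Basis. (f b)\<^sup>2)" for f
    by (subst euclidean_inner) (simp add: power2_eq_square)
  show ?thesis
  proof (rule weakly_converges_of_scores[where p = p and S = UNIV])
    show "random_variable borel (\<lambda>\<omega>. \<chi> k. score n (\<iota> k) \<omega>)" for n
      by (rule borel_measurable_vec_lambda) measurable
    show "p j (\<chi> k. score n (\<iota> k) \<omega>) = score n j \<omega>" if "j \<in> J" for n j \<omega>
      using that \<iota> by (simp add: p_def bij_betw_def f_inv_into_f)
    show "continuous_on UNIV (p j)" for j unfolding p_def by (intro continuous_intros)
    show "compact {x \<in> UNIV. (\<Sum>j\<in>J. (p j x)\<^sup>2) \<le> R}" for R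
    proof -
      have "{x. (\<Sum>j\<in>J. (p j x)\<^sup>2) \<le> R} = cball 0 (sqrt R)"
        unfolding norm2 by (auto simp: norm_eq_sqrt_inner)
      thus ?thesis by simp
    qed
    show "x = y" if "\<And>j. j \<in> J \<Longrightarrow> p j x = p j y" for x y
      unfolding vec_eq_iff
    proof
      fix k
      have "\<iota> k \<in> J" using \<iota> by (auto simp: bij_betw_def)
      from that[OF this] show "x $ k = y $ k" by (simp add: p_def inj)
    qed
    show "prob_space ?Q" unfolding Q by (rule prob_space.prob_space_distr[OF prob_space_std_normal_vector sm])
    show "sets ?Q = sets borel" unfolding Q by simp
    have "integrable (std_normal_vector Basis) (\<lambda>f. \<Sum>b\<in>(Basis :: (real ^ 's) set). (f b)\<^sup>2)"
      by (intro Bochner_Integration.integrable_sum second_moment_std_normal_vector)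
    thus "integrable ?Q (\<lambda>x. \<Sum>j\<in>J. (p j x)\<^sup>2)"
      unfolding Q norm2 by (subst integrable_distr_eq) (simp_all add: norm2s)
    have "(\<integral>x. (\<Sum>j\<in>J. (p j x)\<^sup>2) \<partial>?Q) = (\<integral>f. (\<Sum>b\<in>(Basis :: (real ^ 's) set). (f b)\<^sup>2) \<partial>std_normal_vector Basis)"
      unfolding Q norm2 by (subst integral_distr) (simp_all add: norm2s)
    also have "\<dots> = CARD('s)"
      by (subst Bochner_Integration.integral_sum) (simp_all add: second_moment_std_normal_vector)
    finally show "(\<integral>x. (\<Sum>j\<in>J. (p j x)\<^sup>2) \<partial>?Q) \<le> card J"
      using bij_betw_same_card[OF \<iota>] by simp
    fix t :: "'j \<Rightarrow> real"
    define u where "u = (\<chi> k. t (\<iota> k))"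
    have lin: "(\<Sum>j\<in>J. t j * p j x) = u \<bullet> x" for x by (simp add: sumJ p_def inj inner_vec_def u_def)
    have lins: "u \<bullet> ?s f = (\<Sum>b\<in>Basis. (u \<bullet> b) * f b)" for f
      by (simp add: inner_sum_right mult.commute)
    have "(\<integral>x. iexp (\<Sum>j\<in>J. t j * p j x) \<partial>?Q) = (\<integral>f. iexp (\<Sum>b\<in>Basis. (u \<bullet> b) * f b) \<partial>std_normal_vector Basis)"
      unfolding Q lin by (subst integral_distr) (simp_all only: lins sm, measurable)
    also have "\<dots> = exp (- (\<Sum>b\<in>Basis. (u \<bullet> b)\<^sup>2) / 2)" by (rule characteristic_std_normal_vector) simp
    also have "(\<Sum>b\<in>Basis. (u \<bullet> b)\<^sup>2) = (\<Sum>j\<in>J. (t j)\<^sup>2)"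
      using euclidean_inner[of u u] by (simp add: sumJ inner_vec_def u_def power2_eq_square)
    finally show "(\<integral>x. iexp (\<Sum>j\<in>J. t j * p j x) \<partial>?Q) = exp (- (\<Sum>j\<in>J. (t j)\<^sup>2) / 2)" .
  qed auto
qed

text \<open>Embeds vectors indexed by \<open>I\<close> in the full function space, whose topology does not depend on \<open>I\<close>. Product
  measures use an arbitrary default value outside \<open>I\<close>, which here becomes 0.\<close>

definition extend_by_zero :: "'i set \<Rightarrow> ('i \<Rightarrow> real) \<Rightarrow> 'i \<Rightarrow> real" where
  "extend_by_zero I z i = (if i \<in> I then z i else 0)"

lemma borel_measurable_extend_by_zero:
  fixes X :: "'a \<Rightarrow> 'i::countable \<Rightarrow> real"
  assumes "\<And>i. i \<in> I \<Longrightarrow> (\<lambda>\<omega>. X \<omega> i) \<in> borel_measurable M"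
  shows "(\<lambda>\<omega>. extend_by_zero I (X \<omega>)) \<in> borel_measurable M"
proof (rule measurable_coordinatewise_then_product)
  show "(\<lambda>\<omega>. extend_by_zero I (X \<omega>) i) \<in> borel_measurable M" for i
    using assms by (cases "i \<in> I") (auto simp: extend_by_zero_def)
qed

lemma extend_by_zero_measurable[measurable]:
  "extend_by_zero I \<in> std_normal_vector I \<rightarrow>\<^sub>M (borel :: ('i::countable \<Rightarrow> real) measure)"
  using borel_measurable_extend_by_zero[of I "\<lambda>z. z" "std_normal_vector I"] by auto

text \<open>A closed part of a cube, which is compact by Tychonoff's theorem.\<close>

lemma compact_finite_support_ball:
  fixes I :: "'i set"
  assumes I: "finite I"
  shows "compact {x :: 'i \<Rightarrow> real. (\<forall>i. i \<notin> I \<longrightarrow> x i = 0) \<and> (\<Sum>i\<in>I. (x i)\<^sup>2) \<le> R}" (is "compact ?K")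
proof -
  let ?B = "PiE UNIV (\<lambda>_::'i. {- sqrt (max 0 R)..sqrt (max 0 R)})"
  have "compactin (product_topology (\<lambda>_. euclidean) UNIV) ?B"
    unfolding compactin_PiE by simp
  hence B: "compact ?B" unfolding euclidean_product_topology by simp
  have "closed (\<Inter>i\<in>- I. {x :: 'i \<Rightarrow> real. x i = 0})"
    by (intro closed_INT ballI closed_Collect_eq) (auto intro!: continuous_intros)
  moreover have "closed {x :: 'i \<Rightarrow> real. (\<Sum>i\<in>I. (x i)\<^sup>2) \<le> R}"
    by (intro closed_Collect_le) (auto intro!: continuous_intros)
  moreover have "?K = ?B \<inter> ((\<Inter>i\<in>- I. {x. x i = 0}) \<inter> {x. (\<Sum>i\<in>I. (x i)\<^sup>2) \<le> R})"
  proof -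
    have "x \<in> ?B" if "x \<in> ?K" for x
    proof -
      have "\<bar>x i\<bar> \<le> sqrt (max 0 R)" for i
      proof (cases "i \<in> I")
        case True
        have "(x i)\<^sup>2 \<le> (\<Sum>i\<in>I. (x i)\<^sup>2)" using I True by (intro member_le_sum) auto
        also have "\<dots> \<le> R" using that by simp
        also have "R \<le> max 0 R" by simp
        finally show ?thesis by (simp add: real_le_rsqrt)
      qed (use that in simp)
      thus ?thesis by (auto simp: abs_le_iff minus_le_iff)
    qed
    thus ?thesis by auto
  qed
  ultimately show ?thesis using B by (simp add: compact_Int_closed closed_Int)
qed

lemma std_normal_vector_extended_integral:
  fixes f :: "('i::countable \<Rightarrow> real) \<Rightarrow> 'b::{banach, second_countable_topology}"
  assumes "f \<in> borel_measurable borel"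
  shows "(\<integral>x. f x \<partial>distr (std_normal_vector I) borel (extend_by_zero I)) = (\<integral>z. f (extend_by_zero I z) \<partial>std_normal_vector I)"
  using assms by (intro integral_distr) auto

lemma weak_conv_m_if_weakly_converges:
  assumes "\<And>n. prob_space (P n)" "\<And>n. sets (P n) = sets borel" "prob_space Q" "sets Q = sets borel"
    and conv: "weakly_converges P Q" and G: "continuous_on UNIV G"
  shows "weak_conv_m (\<lambda>n. distr (P n) borel G) (distr Q borel G)"
proof -
  have G': "G \<in> borel_measurable borel" using G by (rule borel_measurable_continuous_onI)
  have GP: "G \<in> borel_measurable (P n)" and GQ: "G \<in> borel_measurable Q" for n
    using G' measurable_cong_sets[OF assms(2) refl] measurable_cong_sets[OF assms(4) refl] by blast+
  interpret real_distribution "distr (P n) borel G" for n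
    using GP assms(1) by (auto simp: real_distribution_def real_distribution_axioms_def intro!: prob_space.prob_space_distr)
  show ?thesis
  proof (rule integral_bdd_continuous_conv_imp_weak_conv)
    show "real_distribution (distr (P n) borel G)" for n by unfold_locales
    show "real_distribution (distr Q borel G)"
      using GQ assms(3) by (auto simp: real_distribution_def real_distribution_axioms_def intro!: prob_space.prob_space_distr)
    fix f :: "real \<Rightarrow> real" assume f: "\<And>x. isCont f x" "\<And>x. \<bar>f x\<bar> \<le> 1"
    have fc: "continuous_on UNIV f" using f(1) continuous_at_imp_continuous_on by blast
    have fm: "f \<in> borel_measurable borel" using fc by (rule borel_measurable_continuous_onI)
    have "continuous_on UNIV (\<lambda>x. f (G x))" by (rule continuous_on_compose2[OF fc G]) auto
    moreover have "bounded (range (\<lambda>x. f (G x)))" using f(2) by (auto simp: bounded_iff)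
    ultimately have "(\<lambda>n. \<integral>x. f (G x) \<partial>P n) \<longlonglongrightarrow> (\<integral>x. f (G x) \<partial>Q)"
      using conv by (simp add: weakly_converges_def)
    thus "(\<lambda>n. integral\<^sup>L (distr (P n) borel G) f) \<longlonglongrightarrow> integral\<^sup>L (distr Q borel G) f"
      using integral_distr[OF GP fm] integral_distr[OF GQ fm] by simp
  qed
qed

text \<open>The continuous mapping theorem for the scores. The vector lives in a function space, so that the number of
  coordinates can vary inside a statement, as the degrees of freedom of the chi-square law do.\<close>

theorem (in orthonormal_chain) weak_conv_function_of_scores:
  fixes \<iota> :: "'i::countable \<Rightarrow> 'j" and G :: "('i \<Rightarrow> real) \<Rightarrow> real"
  assumes \<iota>: "bij_betw \<iota> I J" and G: "continuous_on UNIV G"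
  shows "weak_conv_m (\<lambda>n. distr M borel (\<lambda>\<omega>. G (extend_by_zero I (\<lambda>i. score n (\<iota> i) \<omega>))))
    (distr (std_normal_vector I) borel (\<lambda>z. G (extend_by_zero I z)))"
proof -
  have I: "finite I" using bij_betw_finite[OF \<iota>] finite_J by simp
  let ?X = "\<lambda>n \<omega>. extend_by_zero I (\<lambda>i. score n (\<iota> i) \<omega>)"
  let ?Q = "distr (std_normal_vector I) borel (extend_by_zero I)"
  define p where "p j x = x (inv_into I \<iota> j)" for j and x :: "'i \<Rightarrow> real"
  define S where "S = {x :: 'i \<Rightarrow> real. \<forall>i. i \<notin> I \<longrightarrow> x i = 0}"
  have inv: "inv_into I \<iota> (\<iota> i) = i" if "i \<in> I" for i
    using \<iota> that by (simp add: bij_betw_def inv_into_f_f)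
  have sumJ: "(\<Sum>j\<in>J. g j) = (\<Sum>i\<in>I. g (\<iota> i))" for g :: "'j \<Rightarrow> real"
    using sum.reindex_bij_betw[OF \<iota>, of g] by simp
  have norm2: "(\<Sum>j\<in>J. (p j x)\<^sup>2) = (\<Sum>i\<in>I. (x i)\<^sup>2)" for x
    by (simp add: sumJ p_def inv)
  have ext: "(\<Sum>i\<in>I. h i (extend_by_zero I z i)) = (\<Sum>i\<in>I. h i (z i))" for h :: "'i \<Rightarrow> real \<Rightarrow> real" and z
    by (intro sum.cong refl) (simp add: extend_by_zero_def)
  have X[measurable]: "random_variable borel (?X n)" for n
    by (rule borel_measurable_extend_by_zero) measurable
  have "closed (\<Inter>i\<in>- I. {x :: 'i \<Rightarrow> real. x i = 0})"
    by (intro closed_INT ballI closed_Collect_eq) (auto intro!: continuous_intros)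
  also have "(\<Inter>i\<in>- I. {x :: 'i \<Rightarrow> real. x i = 0}) = S" by (auto simp: S_def)
  finally have S: "S \<in> sets borel" by (rule borel_closed)
  have Qp: "prob_space ?Q" by (rule prob_space.prob_space_distr[OF prob_space_std_normal_vector]) measurable
  have "weakly_converges (\<lambda>n. distr M borel (?X n)) ?Q"
  proof (rule weakly_converges_of_scores[where p = p and S = S, OF X _ _ _ _ _ S Qp])
    show "p j (?X n \<omega>) = score n j \<omega>" if "j \<in> J" for n j \<omega>
      using that \<iota> by (simp add: p_def extend_by_zero_def bij_betw_def f_inv_into_f inv_into_into)
    show "?X n \<omega> \<in> S" for n \<omega> by (simp add: S_def extend_by_zero_def)
    show "continuous_on UNIV (p j)" for j unfolding p_def by simp
    show "compact {x \<in> S. (\<Sum>j\<in>J. (p j x)\<^sup>2) \<le> R}" for R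
      using compact_finite_support_ball[OF I, of R] by (simp add: S_def norm2)
    show "x = y" if "x \<in> S" "y \<in> S" "\<And>j. j \<in> J \<Longrightarrow> p j x = p j y" for x y
    proof
      fix i
      show "x i = y i"
      proof (cases "i \<in> I")
        case True
        hence "\<iota> i \<in> J" using \<iota> by (auto simp: bij_betw_def)
        from that(3)[OF this] True show ?thesis by (simp add: p_def inv)
      next
        case False
        thus ?thesis using that(1,2) by (simp add: S_def)
      qed
    qed
    show "sets ?Q = sets borel" by simp
    show "AE x in ?Q. x \<in> S"
      using S by (subst AE_distr_iff) (auto simp: S_def extend_by_zero_def)
    have [measurable]: "(\<lambda>x::'i \<Rightarrow> real. x i) \<in> borel_measurable borel" for i
      by (rule borel_measurable_continuous_onI) simp
    have "integrable (std_normal_vector I) (\<lambda>z. \<Sum>i\<in>I. (z i)\<^sup>2)"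
      by (intro Bochner_Integration.integrable_sum second_moment_std_normal_vector)
    thus "integrable ?Q (\<lambda>x. \<Sum>j\<in>J. (p j x)\<^sup>2)"
      unfolding norm2 by (subst integrable_distr_eq) (simp_all add: ext[of "\<lambda>_ u. u\<^sup>2"])
    have "(\<integral>x. (\<Sum>j\<in>J. (p j x)\<^sup>2) \<partial>?Q) = (\<integral>z. (\<Sum>i\<in>I. (z i)\<^sup>2) \<partial>std_normal_vector I)"
      unfolding norm2 by (subst std_normal_vector_extended_integral) (simp_all add: ext[of "\<lambda>_ u. u\<^sup>2"])
    also have "\<dots> = card I"
      by (subst Bochner_Integration.integral_sum) (simp_all add: second_moment_std_normal_vector)
    finally show "(\<integral>x. (\<Sum>j\<in>J. (p j x)\<^sup>2) \<partial>?Q) \<le> card J"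
      using bij_betw_same_card[OF \<iota>] by simp
    fix t :: "'j \<Rightarrow> real"
    have lin: "(\<Sum>j\<in>J. t j * p j x) = (\<Sum>i\<in>I. t (\<iota> i) * x i)" for x by (simp add: sumJ p_def inv)
    have "(\<integral>x. iexp (\<Sum>j\<in>J. t j * p j x) \<partial>?Q) = (\<integral>z. iexp (\<Sum>i\<in>I. t (\<iota> i) * z i) \<partial>std_normal_vector I)"
      unfolding lin by (subst std_normal_vector_extended_integral) (simp_all only: ext[of "\<lambda>i u. t (\<iota> i) * u"], measurable)
    thus "(\<integral>x. iexp (\<Sum>j\<in>J. t j * p j x) \<partial>?Q) = exp (- (\<Sum>j\<in>J. (t j)\<^sup>2) / 2)"
      by (simp only: characteristic_std_normal_vector[OF I] sumJ)
  qed
  from weak_conv_m_if_weakly_converges[OF prob_space_distr[OF X] _ Qp _ this G]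
  have "weak_conv_m (\<lambda>n. distr (distr M borel (?X n)) borel G) (distr ?Q borel G)" by simp
  moreover have "G \<in> borel_measurable borel" using G by (rule borel_measurable_continuous_onI)
  ultimately show ?thesis
    by (simp add: distr_distr comp_def)
qed

lemma restrict_std_normal_vector:
  assumes "finite I"
  shows "distr (std_normal_vector UNIV) (std_normal_vector I) (\<lambda>z. restrict z I) = std_normal_vector I"
  using assms by (intro product_prob_space.distr_PiM_restrict_finite[OF product_prob_space_std_normal]) auto

section \<open>The chi-square law\<close>

lemma sum_squares_measurable: "(\<lambda>z. \<Sum>i=1..s. (z i)\<^sup>2) \<in> borel_measurable (std_normal_vector {1..s})"
  by measurable

lemma distr_chi_square:
  assumes "g \<in> borel_measurable borel"
  shows "distr (chi_square s) borel g = distr (std_normal_vector {1..s}) borel (\<lambda>z. g (\<Sum>i=1..s. (z i)\<^sup>2))"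
  unfolding chi_square_def using assms sum_squares_measurable by (simp add: distr_distr comp_def)

text \<open>A chi-square variable with \<open>s\<close> degrees of freedom is a sum of \<open>s\<close> squares of independent standard normal
  variables. Taking all of them from one infinite product makes the classical theorem applicable; a square has mean
  \<open>1\<close> and variance \<open>3 - 1 = 2\<close> by the fourth moment of the normal law.\<close>

theorem chi_square_clt:
  "weak_conv_m (\<lambda>s. distr (chi_square s) borel (\<lambda>y. 1 / sqrt (2 * real s) * (y - real s))) std_normal_distribution"
proof -
  let ?N = "std_normal_vector (UNIV :: nat set)"
  interpret N: prob_space ?N by (rule prob_space_std_normal_vector)
  \<comment> \<open>The shift matches the index set \<open>{1..s}\<close> of the chi-square law with sums over \<open>i < s\<close>.\<close>
  define X where "X i z = (z (Suc i))\<^sup>2" for i and z :: "nat \<Rightarrow> real"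
  have m2: "(\<integral>x. x ^ 2 \<partial>std_normal_distribution) = 1" and m4: "(\<integral>x. x ^ 4 \<partial>std_normal_distribution) = 3"
    using std_normal_distribution_even_moments(1)[of 1] std_normal_distribution_even_moments(1)[of 2]
    by (simp_all add: fact_numeral)
  have D: "distr ?N std_normal_distribution (\<lambda>z. z i) = std_normal_distribution" for i
    by (rule product_prob_space.PiM_component[OF product_prob_space_std_normal]) simp
  have pm[measurable]: "(\<lambda>z. z i) \<in> ?N \<rightarrow>\<^sub>M std_normal_distribution" for i
    by (rule measurable_component_singleton) simp
  have E: "N.expectation (\<lambda>z. f (z i)) = (\<integral>x. f x \<partial>std_normal_distribution)"
    if "f \<in> borel_measurable borel" for f :: "real \<Rightarrow> real" and i
    using integral_distr[OF pm, of f i] that by (simp add: D)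
  have I: "integrable ?N (\<lambda>z. f (z i))" if "integrable std_normal_distribution f" for f :: "real \<Rightarrow> real" and i
    using integrable_distr[OF pm[of i], of f] that by (simp add: D)
  have D': "distr ?N borel (\<lambda>z. z i) = std_normal_distribution" for i
    using D[of i] by (simp cong: distr_cong)
  have [measurable]: "N.random_variable borel (\<lambda>z. z i)" for i
    using pm[of i] by simp
  have "distr ?N ?N (\<lambda>z. \<lambda>i\<in>UNIV. z (Suc i)) = std_normal_vector UNIV"
    by (rule distr_PiM_reindex) (auto intro: prob_space_std_normal)
  hence "N.indep_vars (\<lambda>_. borel) (\<lambda>i z. z (Suc i)) UNIV"
    by (subst N.indep_vars_iff_distr_eq_PiM) (simp_all add: D' sets_std_normal_vector cong: distr_cong)
  hence "N.indep_vars (\<lambda>_. borel) X UNIV"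
    unfolding X_def by (rule N.indep_vars_compose2) auto
  moreover have "N.expectation (X i) = 1" for i
    unfolding X_def by (subst E) (simp_all add: m2)
  moreover have iX2: "integrable ?N (\<lambda>z. (X i z)\<^sup>2)" for i
    unfolding X_def power_mult[symmetric] by (rule I) (rule integrable_std_normal_distribution_moment)
  moreover have "N.variance (X i) = (sqrt 2)\<^sup>2" for i
  proof -
    have "integrable ?N (X i)" unfolding X_def by (rule I) (rule integrable_std_normal_distribution_moment)
    hence "N.variance (X i) = N.expectation (\<lambda>z. (X i z)\<^sup>2) - (N.expectation (X i))\<^sup>2"
      using iX2 by (rule N.variance_eq)
    also have "N.expectation (\<lambda>z. (X i z)\<^sup>2) = 3"
      unfolding X_def power_mult[symmetric] by (subst E) (simp_all add: m4)
    finally show ?thesis using \<open>\<And>i. N.expectation (X i) = 1\<close> by simp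
  qed
  moreover have "distr ?N borel (X i) = distr std_normal_distribution borel (\<lambda>x. x\<^sup>2)" for i
  proof -
    have "distr std_normal_distribution borel (\<lambda>x. x\<^sup>2) = distr (distr ?N std_normal_distribution (\<lambda>z. z (Suc i))) borel (\<lambda>x. x\<^sup>2)"
      by (simp add: D)
    also have "\<dots> = distr ?N borel (X i)" by (subst distr_distr) (simp_all add: comp_def X_def[abs_def])
    finally show ?thesis ..
  qed
  ultimately have "weak_conv_m (\<lambda>n. distr ?N borel (\<lambda>z. (\<Sum>i<n. X i z - 1) / sqrt (n * (sqrt 2)\<^sup>2))) std_normal_distribution"
    by (intro N.central_limit_theorem) auto
  moreover have "distr ?N borel (\<lambda>z. (\<Sum>i<n. X i z - 1) / sqrt (n * (sqrt 2)\<^sup>2))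
      = distr (chi_square n) borel (\<lambda>y. 1 / sqrt (2 * real n) * (y - real n))" for n
  proof -
    have "distr (chi_square n) borel (\<lambda>y. 1 / sqrt (2 * real n) * (y - real n))
        = distr (std_normal_vector {1..n}) borel (\<lambda>z. 1 / sqrt (2 * real n) * ((\<Sum>i=1..n. (z i)\<^sup>2) - real n))"
      by (rule distr_chi_square) measurable
    also have "\<dots> = distr (distr ?N (std_normal_vector {1..n}) (\<lambda>z. restrict z {1..n})) borel
        (\<lambda>z. 1 / sqrt (2 * real n) * ((\<Sum>i=1..n. (z i)\<^sup>2) - real n))"
      by (simp add: restrict_std_normal_vector)
    also have "\<dots> = distr ?N borel (\<lambda>z. 1 / sqrt (2 * real n) * ((\<Sum>i=1..n. (z i)\<^sup>2) - real n))"
    proof -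
      have "(\<lambda>z. restrict z {1..n}) \<in> ?N \<rightarrow>\<^sub>M std_normal_vector {1..n}"
        by (rule measurable_restrict_subset) simp
      moreover have "(\<lambda>z. 1 / sqrt (2 * real n) * ((\<Sum>i=1..n. (z i)\<^sup>2) - real n)) \<in> borel_measurable (std_normal_vector {1..n})"
        by (rule measurable_compose[OF sum_squares_measurable]) measurable
      ultimately show ?thesis by (simp add: distr_distr comp_def)
    qed
    also have "(\<lambda>z. 1 / sqrt (2 * real n) * ((\<Sum>i=1..n. (z i)\<^sup>2) - real n)) = (\<lambda>z. (\<Sum>i<n. X i z - 1) / sqrt (n * (sqrt 2)\<^sup>2))"
      by (simp add: X_def sum_subtractf sum.atLeast1_atMost_eq mult.commute)
    finally show ?thesis ..
  qed
  ultimately show ?thesis by simp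
qed

section \<open>The trigonometric estimators\<close>

lemma expectation_uniform_unit_interval:
  fixes f :: "real \<Rightarrow> real"
  assumes [measurable]: "f \<in> borel_measurable borel"
  shows "(\<integral>x. f x \<partial>uniform_measure lborel {0<..<1}) = (LBINT x=0..1. f x)"
proof -
  have "uniform_measure lborel {0<..<1::real} = density lborel (\<lambda>x. ennreal (indicator {0<..<1} x))"
    by (simp add: uniform_measure_def divide_ennreal_def ennreal_indicator)
  hence "(\<integral>x. f x \<partial>uniform_measure lborel {0<..<1}) = (\<integral>x. indicator {0<..<1} x *\<^sub>R f x \<partial>lborel)"
    by (simp add: integral_density)
  thus ?thesis by (simp add: interval_lebesgue_integral_def set_lebesgue_integral_def einterval_eq zero_ereal_def one_ereal_def)
qed

lemma mean_cos_period:
  fixes m :: int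
  shows "(\<integral>x. cos (2 * pi * m * x) \<partial>uniform_measure lborel {0<..<1}) = (if m = 0 then 1 else 0)"
proof (cases "m = 0")
  case True
  thus ?thesis by (simp add: expectation_uniform_unit_interval)
next
  case False
  have "(LBINT x=ereal 0..ereal 1. cos (2 * pi * m * x)) = sin (2 * pi * m * 1) / (2 * pi * m) - sin (2 * pi * m * 0) / (2 * pi * m)"
    using False by (intro interval_integral_FTC_finite)
      (auto intro!: continuous_intros derivative_eq_intros simp flip: has_real_derivative_iff_has_vector_derivative)
  also have "sin (2 * pi * m * 1) = 0" using sin_int_2pin[of m] by (simp add: mult.commute)
  finally show ?thesis using False by (simp add: expectation_uniform_unit_interval zero_ereal_def one_ereal_def)
qed

lemma mean_sin_period:
  fixes m :: int
  shows "(\<integral>x. sin (2 * pi * m * x) \<partial>uniform_measure lborel {0<..<1}) = 0"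
proof (cases "m = 0")
  case False
  have "(LBINT x=ereal 0..ereal 1. sin (2 * pi * m * x)) = (- cos (2 * pi * m * 1) / (2 * pi * m)) - (- cos (2 * pi * m * 0) / (2 * pi * m))"
    using False by (intro interval_integral_FTC_finite)
      (auto intro!: continuous_intros derivative_eq_intros simp flip: has_real_derivative_iff_has_vector_derivative)
  also have "cos (2 * pi * m * 1) = 1" using cos_int_2pin[of m] by (simp add: mult.commute)
  finally show ?thesis by (simp add: expectation_uniform_unit_interval zero_ereal_def one_ereal_def)
qed simp

text \<open>The factor \<open>\<surd>2\<close> normalises the functions in \<open>L\<^sup>2\<close>; two of them account for the factor 2 in the estimators.\<close>

fun trig :: "label \<Rightarrow> real \<Rightarrow> real" where
  "trig (Lambda k) x = sqrt 2 * cos (2 * pi * real k * x)"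
| "trig (Mu k) x = sqrt 2 * sin (2 * pi * real k * x)"

lemma trig_measurable[measurable]: "trig l \<in> borel_measurable borel"
  by (cases l) (auto simp: trig.simps[abs_def])

lemma trig_bounded: "\<bar>trig l x\<bar> \<le> sqrt 2"
  by (cases l) (auto simp: abs_mult mult_le_cancel_left1)

lemma trig_mean:
  assumes "l \<in> labels"
  shows "(\<integral>x. trig l x \<partial>uniform_measure lborel {0<..<1}) = 0"
proof (cases l)
  case (Lambda k)
  hence "k \<noteq> 0" using assms by (auto simp: labels_def)
  thus ?thesis using mean_cos_period[of "int k"] by (simp add: Lambda)
next
  case (Mu k)
  thus ?thesis using mean_sin_period[of "int k"] by (simp add: Mu)
qed

text \<open>Products of sines and cosines are half sums of cosines or sines of the frequencies \<open>k - k'\<close> and \<open>k + k'\<close>, and the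
  only wave with a nonzero mean is the cosine of frequency zero. As \<open>k > 0\<close>, it occurs just for \<open>k = k'\<close> in the first of the two.\<close>

lemma trig_orthonormal:
  assumes "l \<in> labels" "l' \<in> labels"
  shows "(\<integral>x. trig l x * trig l' x \<partial>uniform_measure lborel {0<..<1}) = (if l = l' then 1 else 0)"
proof -
  let ?u = "uniform_measure lborel {0<..<1::real}"
  interpret prob_space ?u by (rule prob_space_uniform_measure) auto
  have int: "integrable ?u (\<lambda>x. cos (2 * pi * m * x))" "integrable ?u (\<lambda>x. sin (2 * pi * m * x))" for m
    by (auto intro!: integrable_const_bound[of _ 1])
  have split: "cos (2 * pi * k * x) * cos (2 * pi * k' * x) * 2 = cos (2 * pi * (k - k') * x) + cos (2 * pi * (k + k') * x)"
    "sin (2 * pi * k * x) * sin (2 * pi * k' * x) * 2 = cos (2 * pi * (k - k') * x) - cos (2 * pi * (k + k') * x)"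
    "sin (2 * pi * k * x) * cos (2 * pi * k' * x) * 2 = sin (2 * pi * (k + k') * x) + sin (2 * pi * (k - k') * x)"
    for k k' x :: real
    by (simp_all add: distrib_left distrib_right left_diff_distrib right_diff_distrib cos_add cos_diff sin_add sin_diff)
  have r: "sqrt 2 * a * (sqrt 2 * b) = a * b * 2" for a b :: real
    by (simp add: mult_ac)
  have cc: "(\<integral>x. cos (2 * pi * real k * x) * cos (2 * pi * real k' * x) * 2 \<partial>?u) = (if k = k' then 1 else 0)"
    and ss: "(\<integral>x. sin (2 * pi * real k * x) * sin (2 * pi * real k' * x) * 2 \<partial>?u) = (if k = k' then 1 else 0)"
    if "k \<noteq> 0" for k k' :: nat
    unfolding split using int that mean_cos_period[of "int k - int k'"] mean_cos_period[of "int k + int k'"] by simp_all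
  have sc: "(\<integral>x. sin (2 * pi * real k * x) * cos (2 * pi * real k' * x) * 2 \<partial>?u) = 0" for k k' :: nat
    unfolding split using int mean_sin_period[of "int k - int k'"] mean_sin_period[of "int k + int k'"] by simp
  have cs: "(\<integral>x. cos (2 * pi * real k * x) * sin (2 * pi * real k' * x) * 2 \<partial>?u) = 0" for k k' :: nat
    using sc[of k' k] by (simp add: mult.commute)
  show ?thesis
  proof (cases l)
    case l: (Lambda k)
    hence k: "k \<noteq> 0" using assms by (auto simp: labels_def)
    show ?thesis unfolding l by (cases l') (simp_all only: trig.simps r cc[OF k] cs label.inject label.distinct if_False)
  next
    case l: (Mu k)
    hence k: "k \<noteq> 0" using assms by (auto simp: labels_def)
    show ?thesis unfolding l by (cases l') (simp_all only: trig.simps r ss[OF k] sc label.inject label.distinct if_False)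
  qed
qed

text \<open>The joint distribution function of two neighbours is the independence copula, the product of the marginals.\<close>

lemma independent_chain_if_parameters_vanish:
  assumes M: "prob_space M" and c: "square_integrable_copula C c" and series: "sine_cosine_series c lam mu"
    and chain: "copula_markov_chain M C U" and zero: "\<forall>k\<ge>1. lam k = 0 \<and> mu k = 0"
  shows "independent_chain M U"
proof -
  interpret prob_space M by (rule M)
  have [measurable]: "random_variable borel (U i)" for i
    using chain by (simp add: copula_markov_chain_def)
  have marginal: "prob {\<omega> \<in> space M. U i \<omega> \<le> u} = measure (uniform_measure lborel {0<..<1}) {..u}" for i u
  proof -
    have "measure (distr M borel (U i)) {..u} = prob (U i -` {..u} \<inter> space M)" by (rule measure_distr) auto
    also have "U i -` {..u} \<inter> space M = {\<omega> \<in> space M. U i \<omega> \<le> u}" by auto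
    finally show ?thesis using chain by (simp add: copula_markov_chain_def)
  qed
  show ?thesis
  proof unfold_locales
    show "markov_property M U" using chain by (simp add: copula_markov_chain_def)
    fix i
    show "random_variable borel (U i)" by measurable
    show "indep_var borel (U i) borel (U (Suc i))"
    proof (rule indep_var_if_joint_cdf_factors)
      fix u v
      have "prob {\<omega> \<in> space M. U i \<omega> \<le> u \<and> U (Suc i) \<omega> \<le> v} = C u v"
        using chain by (simp add: copula_markov_chain_def)
      also have "\<dots> = measure (uniform_measure lborel {0<..<1}) {..u} * measure (uniform_measure lborel {0<..<1}) {..v}"
        using copula_is_product_if_density_eq_one density_eq_one_if_coefficients_vanish[OF c series zero] c
        by (auto simp: square_integrable_copula_def)
      finally show "prob {\<omega> \<in> space M. U i \<omega> \<le> u \<and> U (Suc i) \<omega> \<le> v}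
          = prob {\<omega> \<in> space M. U i \<omega> \<le> u} * prob {\<omega> \<in> space M. U (Suc i) \<omega> \<le> v}"
        by (simp only: marginal)
    qed measurable
  qed
qed

lemma orthonormal_chain_of_labels:
  fixes V :: "'j \<Rightarrow> label"
  assumes chain: "independent_chain M U" and uniform: "\<And>i. distr M borel (U i) = uniform_measure lborel {0<..<1}"
    and J: "finite J" "inj_on V J" "V ` J \<subseteq> labels"
  shows "orthonormal_chain M U (\<lambda>j. trig (V j)) J (sqrt 2)"
proof -
  interpret independent_chain M U by (rule chain)
  have E: "expectation (\<lambda>\<omega>. f (U i \<omega>)) = (\<integral>x. f x \<partial>uniform_measure lborel {0<..<1})"
    if "f \<in> borel_measurable borel" for f :: "real \<Rightarrow> real" and i
    using integral_distr[OF U that] by (simp add: uniform)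
  show ?thesis
  proof unfold_locales
    show "finite J" by fact
    show "trig (V j) \<in> borel_measurable borel" for j by measurable
    show "\<bar>trig (V j) x\<bar> \<le> sqrt 2" for j x by (rule trig_bounded)
    show "expectation (\<lambda>\<omega>. trig (V j) (U i \<omega>)) = 0" if "j \<in> J" for i j
      using trig_mean[of "V j"] J(3) that by (subst E) auto
    show "expectation (\<lambda>\<omega>. trig (V j) (U i \<omega>) * trig (V k) (U i \<omega>)) = (if j = k then 1 else 0)"
      if "j \<in> J" "k \<in> J" for i j k
      using trig_orthonormal[of "V j" "V k"] J that by (subst E) (auto simp: inj_on_eq_iff image_subset_iff)
  qed
qed

text \<open>The summation is shifted to start at 0, which is the indexing of the steps. At \<open>n = 0\<close> both sides are 0.\<close>

lemma sqrt_times_estimator: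
  "sqrt (real n) * estimator U l n \<omega> = (\<Sum>i<n. trig l (U i \<omega>) * trig l (U (Suc i) \<omega>)) / sqrt n"
proof -
  have two: "sqrt 2 * a * (sqrt 2 * b) = 2 * a * b" for a b :: real by simp
  have "estimator U l n \<omega> = (1 / real n) * (\<Sum>i=1..n. trig l (U i \<omega>) * trig l (U (i - 1) \<omega>))"
    by (cases l) (simp_all only: estimator.simps lambda_hat_def mu_hat_def trig.simps two)
  also have "(\<Sum>i=1..n. trig l (U i \<omega>) * trig l (U (i - 1) \<omega>)) = (\<Sum>i<n. trig l (U i \<omega>) * trig l (U (Suc i) \<omega>))"
    by (simp add: sum.atLeast1_atMost_eq mult.commute)
  finally have e: "estimator U l n \<omega> = (\<Sum>i<n. trig l (U i \<omega>) * trig l (U (Suc i) \<omega>)) / real n" by simp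
  have "sqrt (real n) * (a / real n) = a / sqrt n" for a
  proof -
    have "real n = sqrt (real n) * sqrt (real n)" by simp
    thus ?thesis by (cases "n = 0") (simp_all add: field_simps)
  qed
  thus ?thesis unfolding e .
qed

theorem proposition3p4:
  fixes M :: "'a measure"
    and U :: "nat \<Rightarrow> 'a \<Rightarrow> real"
    and C c :: "real \<Rightarrow> real \<Rightarrow> real"
    and lam mu :: "nat \<Rightarrow> real"
  assumes "prob_space M"
    and "square_integrable_copula C c"
    and "sine_cosine_series c lam mu"
    and "copula_markov_chain M C U"
    and "\<forall>k\<ge>1. lam k = 0 \<and> mu k = 0"
  shows "(\<forall>V :: 's::finite \<Rightarrow> label. inj V \<and> range V \<subseteq> labels \<longrightarrow>
            weakly_converges
              (\<lambda>n. distr M borel (\<lambda>\<omega>. sqrt (real n) *\<^sub>R (\<chi> j. estimator U (V j) n \<omega>)))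
              (normal_distribution 0 (mat 1)))
       \<and> (\<forall>W :: nat \<Rightarrow> label. inj_on W {1..} \<and> W ` {1..} \<subseteq> labels \<longrightarrow>
            (\<forall>s\<ge>1. weak_conv_m
              (\<lambda>n. distr M borel (\<lambda>\<omega>. real n * (\<Sum>i=1..s. (estimator U (W i) n \<omega>)\<^sup>2)))
              (chi_square s))
          \<and> (\<exists>Q :: nat \<Rightarrow> real measure.
              (\<forall>s\<ge>1. real_distribution (Q s) \<and> weak_conv_m
                (\<lambda>n. distr M borel (\<lambda>\<omega>. 1 / sqrt (2 * real s) *
                  (real n * (\<Sum>i=1..s. (estimator U (W i) n \<omega>)\<^sup>2) - real s)))
                (Q s))
            \<and> weak_conv_m Q std_normal_distribution))"
proof (intro conjI allI impI)
  have chain: "independent_chain M U" by (rule independent_chain_if_parameters_vanish[OF assms])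
  have uniform: "distr M borel (U i) = uniform_measure lborel {0<..<1}" for i
    using assms(4) by (simp add: copula_markov_chain_def)
  {
    fix V :: "'s \<Rightarrow> label" assume V: "inj V \<and> range V \<subseteq> labels"
    interpret orthonormal_chain M U "\<lambda>j. trig (V j)" UNIV "sqrt 2"
      by (rule orthonormal_chain_of_labels[OF chain uniform]) (use V in auto)
    have "sqrt (real n) *\<^sub>R (\<chi> j. estimator U (V j) n \<omega>) = (\<chi> j. score n j \<omega>)" for n \<omega>
      by (simp add: vec_eq_iff sqrt_times_estimator score_def)
    thus "weakly_converges (\<lambda>n. distr M borel (\<lambda>\<omega>. sqrt (real n) *\<^sub>R (\<chi> j. estimator U (V j) n \<omega>)))
        (normal_distribution 0 (mat 1))"
      using weakly_converges_of_score_vector[of "\<lambda>j. j"] by (simp add: bij_betw_def)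
  }
  fix W :: "nat \<Rightarrow> label" assume W: "inj_on W {1..} \<and> W ` {1..} \<subseteq> labels"
  have conv: "weak_conv_m (\<lambda>n. distr M borel (\<lambda>\<omega>. g (real n * (\<Sum>i=1..s. (estimator U (W i) n \<omega>)\<^sup>2))))
      (distr (chi_square s) borel g)" if g: "continuous_on UNIV g" for g :: "real \<Rightarrow> real" and s
  proof -
    interpret orthonormal_chain M U "\<lambda>j. trig (W j)" "{1..s}" "sqrt 2"
      by (rule orthonormal_chain_of_labels[OF chain uniform]) (use W in \<open>auto intro: inj_on_subset\<close>)
    let ?G = "\<lambda>x :: nat \<Rightarrow> real. g (\<Sum>i=1..s. (x i)\<^sup>2)"
    have G: "continuous_on UNIV ?G"
      by (intro continuous_on_compose2[OF g] continuous_intros continuous_on_product_coordinates) auto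
    have sum_ext: "(\<Sum>i=1..s. (extend_by_zero {1..s} z i)\<^sup>2) = (\<Sum>i=1..s. (z i)\<^sup>2)" for z
      by (intro sum.cong refl) (simp add: extend_by_zero_def)
    have "real n * (estimator U l n \<omega>)\<^sup>2 = (sqrt (real n) * estimator U l n \<omega>)\<^sup>2" for n l \<omega>
      by (simp add: power_mult_distrib)
    hence score: "real n * (\<Sum>i=1..s. (estimator U (W i) n \<omega>)\<^sup>2) = (\<Sum>i=1..s. (score n i \<omega>)\<^sup>2)" for n \<omega>
      by (simp only: sum_distrib_left sqrt_times_estimator score_def)
    have gm: "g \<in> borel_measurable borel" using g by (rule borel_measurable_continuous_onI)
    from distr_chi_square[OF gm, of s, symmetric]
      weak_conv_function_of_scores[of "\<lambda>i. i" "{1..s}" ?G, OF _ G]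
    show ?thesis unfolding score sum_ext by (simp add: bij_betw_def)
  qed
  have id: "distr (chi_square s) borel (\<lambda>y. y) = chi_square s" for s
    by (rule distr_id2) (simp add: chi_square_def)
  show "weak_conv_m (\<lambda>n. distr M borel (\<lambda>\<omega>. real n * (\<Sum>i=1..s. (estimator U (W i) n \<omega>)\<^sup>2))) (chi_square s)"
    for s using conv[of "\<lambda>y. y" s] by (simp add: id continuous_on_id)
  let ?Q = "\<lambda>s. distr (chi_square s) borel (\<lambda>y. 1 / sqrt (2 * real s) * (y - real s))"
  have "real_distribution (?Q s)" for s
  proof -
    have "prob_space (chi_square s)"
      unfolding chi_square_def by (rule prob_space.prob_space_distr[OF prob_space_std_normal_vector]) measurable
    moreover have "(\<lambda>y. 1 / sqrt (2 * real s) * (y - real s)) \<in> borel_measurable (chi_square s)"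
      by (simp add: chi_square_def)
    ultimately have "prob_space (?Q s)" by (rule prob_space.prob_space_distr)
    thus ?thesis by (simp add: real_distribution_def real_distribution_axioms_def)
  qed
  moreover have "weak_conv_m (\<lambda>n. distr M borel (\<lambda>\<omega>. 1 / sqrt (2 * real s) *
        (real n * (\<Sum>i=1..s. (estimator U (W i) n \<omega>)\<^sup>2) - real s))) (?Q s)" for s
    by (rule conv) (intro continuous_intros)
  ultimately show "\<exists>Q :: nat \<Rightarrow> real measure.
      (\<forall>s\<ge>1. real_distribution (Q s) \<and> weak_conv_m
        (\<lambda>n. distr M borel (\<lambda>\<omega>. 1 / sqrt (2 * real s) *
          (real n * (\<Sum>i=1..s. (estimator U (W i) n \<omega>)\<^sup>2) - real s))) (Q s))
      \<and> weak_conv_m Q std_normal_distribution"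
    using chi_square_clt by (intro exI[of _ ?Q]) simp
qed

end
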